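(* Let $\Phi$ be a finite root system of rank $d$ in $V$, with Weyl group $W$, simple reflections $s_1,\dots,s_d$, fundamental weights $\lambda_1,\dots,\lambda_d$, Cartan matrix $A$, and $\mathscr{R}=W\{\lambda_1,\dots,\lambda_d\}$. For a function $h:\mathscr{R}\to\mathbb{R}$, the following are equivalent: (0) $h$ is $\Phi$-submodular; (1) (local $\Phi$-submodularity) for every $w\in W$ and every $i\in[d]$, $$h(w\lambda_i)+h(ws_i\lambda_i)\ \ge\ \sum_{j\in N(i)} -A_{ji}\,h(w\lambda_j),$$ where $N(i)$ is the set of neighbors of $i$ in the Dynkin diagram (not including $i$); (2) (global $\Phi$-submodularity) for any $\lambda,\lambda'\in\mathscr{R}$, $$h(\lambda)+h(\lambda')\ \ge\ \tilde h(\lambda+\lambda'),$$ where $\tilde h$ denotes the unique continuous function on $V$ that is linear on each cone of the Coxeter complex $\Sigma_\Phi$ and agrees with $h$ on $\mathscr{R}$. Consequently, the map $h\mapsto P_h:=\{v\in V:\langle\lambda,v\rangle\le h(\lambda)\text{ for all }\lambda\in\mathscr{R}\}$ is a bijection between functions satisfying (1) (equivalently (2)) and deformations of the $\Phi$-permutohedron.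
   Context: $V$ is a finite-dimensional real vector space with positive definite inner product $\langle\cdot,\cdot\rangle$. For $v\neq0$ let $s_v(x)=x-\frac{2\langle x,v\rangle}{\langle v,v\rangle}v$. A finite root system is a finite set $\Phi\subset V$ spanning $V$ such that for each $\alpha\in\Phi$ the only scalar multiples of $\alpha$ in $\Phi$ are $\pm\alpha$, and $s_\alpha(\Phi)=\Phi$ (not necessarily crystallographic). The Weyl group $W$ is the finite group generated by all $s_\alpha$, $\alpha\in\Phi$. The Coxeter complex $\Sigma_\Phi$ is the complete simplicial fan whose maximal cones (chambers) are the closures of the connected components of $V\setminus\bigcup_{\alpha\in\Phi}\alpha^\perp$. Fix a chamber $D$; the simple roots $\alpha_1,\dots,\alpha_d$ ($d=\dim V$) are the roots such that $D=\{x:\langle\alpha_i,x\rangle\ge0\ \forall i\}$ is an irredundant description; $s_i=s_{\alpha_i}$; positive roots $\Phi^+$ are roots that are nonnegative combinations of simple roots. Coroots: $\alpha^\vee=2\alpha/\langle\alpha,\alpha\rangle$. Cartan matrix: $A_{ij}=\langle\alpha_i^\vee,\alpha_j\rangle$. Fundamental weights: the basis $\lambda_1,\dots,\lambda_d$ of $V$ with $\langle\lambda_i,\alpha_j^\vee\rangle=\delta_{ij}$; they span the rays of $D$, and each ray of $\Sigma_\Phi$ contains exactly one element of $\mathscr{R}=W\{\lambda_1,\dots,\lambda_d\}$, so functions $\mathscr{R}\to\mathbb{R}$ correspond bijectively to continuous functions on $V$ linear on each cone of $\Sigma_\Phi$. Coxeter matrix: $m_{ij}$ is the order of $s_is_j$;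 the Dynkin diagram has vertex set $[d]$ and an edge labelled $m_{ij}$ between $i\ne j$ whenever $m_{ij}>2$ (equivalently $A_{ij}\neq0$). The $\Phi$-permutohedron is $\Pi_\Phi=\sum_{\alpha\in\Phi^+}[-\alpha/2,\alpha/2]$; its normal fan is $\Sigma_\Phi$ (identifying $V$ with its dual via the inner product). A deformation of $\Pi_\Phi$ (generalized $\Phi$-permutohedron) is a polytope whose (outer) normal fan coarsens $\Sigma_\Phi$. The support function of a polytope $P$ is $h_P(u)=\max_{v\in P}\langle u,v\rangle$. A function $h:\mathscr{R}\to\mathbb{R}$ is $\Phi$-submodular if its piecewise-linear extension $\tilde h$ (as in (2)) is convex; equivalently, $h$ is the restriction to $\mathscr{R}$ of the support function of a deformation of $\Pi_\Phi$ (namely of $P_h$). *)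

theory Defs
  imports "HOL-Analysis.Analysis" "HOL-Algebra.Bij" "HOL-Algebra.Generated_Groups"
    "HOL-Algebra.Multiplicative_Group"
begin

text \<open>
  The ambient space V is a type of class \<open>euclidean_space\<close>, of dimension \<open>d = DIM('a)\<close>. Families
  indexed by [d] are functions on \<open>nat\<close> of which only the values at \<open>1, \<dots>, d\<close> matter.
\<close>

definition reflection :: "'a::euclidean_space \<Rightarrow> 'a \<Rightarrow> 'a" where
  "reflection v x = x - (2 * (x \<bullet> v) / (v \<bullet> v)) *\<^sub>R v"

definition coroot :: "'a::euclidean_space \<Rightarrow> 'a" where
  "coroot v = (2 / (v \<bullet> v)) *\<^sub>R v"

definition root_system :: "'a::euclidean_space set \<Rightarrow> bool" where
  "root_system \<Phi> \<longleftrightarrow>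
     finite \<Phi> \<and> span \<Phi> = UNIV \<and> 0 \<notin> \<Phi> \<and>
     (\<forall>\<alpha>\<in>\<Phi>. \<Phi> \<inter> range (\<lambda>c. c *\<^sub>R \<alpha>) = {\<alpha>, - \<alpha>}) \<and>
     (\<forall>\<alpha>\<in>\<Phi>. reflection \<alpha> ` \<Phi> = \<Phi>)"

definition weyl_group :: "'a::euclidean_space set \<Rightarrow> ('a \<Rightarrow> 'a) set" where
  "weyl_group \<Phi> = generate (BijGroup UNIV) (reflection ` \<Phi>)"


subsection \<open>Coxeter complex\<close>

definition chambers :: "'a::euclidean_space set \<Rightarrow> 'a set set" where
  "chambers \<Phi> = closure ` components (UNIV - (\<Union>\<alpha>\<in>\<Phi>. {x. \<alpha> \<bullet> x = 0}))"

text \<open>A fan is represented by the set of all its cones; the cones of a fan with given maximal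
  cones are the nonempty faces of these.\<close>

definition coxeter_complex :: "'a::euclidean_space set \<Rightarrow> 'a set set" where
  "coxeter_complex \<Phi> = {\<sigma>. \<sigma> \<noteq> {} \<and> (\<exists>C\<in>chambers \<Phi>. \<sigma> face_of C)}"


subsection \<open>Simple roots, Cartan matrix, Dynkin diagram, fundamental weights\<close>

definition simple_roots ::
    "'a::euclidean_space set \<Rightarrow> 'a set \<Rightarrow> (nat \<Rightarrow> 'a) \<Rightarrow> bool" where
  "simple_roots \<Phi> D \<alpha> \<longleftrightarrow>
     (\<forall>i\<in>{1..DIM('a)}. \<alpha> i \<in> \<Phi>) \<and>
     D = {x. \<forall>i\<in>{1..DIM('a)}. \<alpha> i \<bullet> x \<ge> 0} \<and>
     (\<forall>i\<in>{1..DIM('a)}. D \<noteq> {x. \<forall>j\<in>{1..DIM('a)} - {i}. \<alpha> j \<bullet> x \<ge> 0})"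

definition cartan_matrix :: "(nat \<Rightarrow> 'a::euclidean_space) \<Rightarrow> nat \<Rightarrow> nat \<Rightarrow> real" where
  "cartan_matrix \<alpha> i j = coroot (\<alpha> i) \<bullet> \<alpha> j"

definition coxeter_matrix :: "(nat \<Rightarrow> 'a::euclidean_space) \<Rightarrow> nat \<Rightarrow> nat \<Rightarrow> nat" where
  "coxeter_matrix \<alpha> i j =
     group.ord (BijGroup UNIV) (reflection (\<alpha> i) \<circ> reflection (\<alpha> j))"

definition dynkin_neighbors :: "(nat \<Rightarrow> 'a::euclidean_space) \<Rightarrow> nat \<Rightarrow> nat set" where
  "dynkin_neighbors \<alpha> i = {j \<in> {1..DIM('a)}. j \<noteq> i \<and> coxeter_matrix \<alpha> i j > 2}"

definition fundamental_weights ::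
    "(nat \<Rightarrow> 'a::euclidean_space) \<Rightarrow> (nat \<Rightarrow> 'a) \<Rightarrow> bool" where
  "fundamental_weights \<alpha> \<omega> \<longleftrightarrow>
     inj_on \<omega> {1..DIM('a)} \<and> independent (\<omega> ` {1..DIM('a)}) \<and>
     span (\<omega> ` {1..DIM('a)}) = UNIV \<and>
     (\<forall>i\<in>{1..DIM('a)}. \<forall>j\<in>{1..DIM('a)}.
        \<omega> i \<bullet> coroot (\<alpha> j) = (if i = j then 1 else 0))"

definition weight_rays :: "'a::euclidean_space set \<Rightarrow> (nat \<Rightarrow> 'a) \<Rightarrow> 'a set" where
  "weight_rays \<Phi> \<omega> = (\<Union>w\<in>weyl_group \<Phi>. (\<lambda>i. w (\<omega> i)) ` {1..DIM('a)})"


subsection \<open>Submodularity\<close>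

definition pl_on_fan :: "'a::euclidean_space set set \<Rightarrow> ('a \<Rightarrow> real) \<Rightarrow> bool" where
  "pl_on_fan F f \<longleftrightarrow>
     continuous_on UNIV f \<and> (\<forall>\<sigma>\<in>F. \<exists>g. linear g \<and> (\<forall>x\<in>\<sigma>. f x = g x))"

text \<open>In what follows, only the restriction of \<open>h\<close> to \<open>weight_rays \<Phi> \<omega>\<close> matters.\<close>

definition pl_extension ::
    "'a::euclidean_space set \<Rightarrow> (nat \<Rightarrow> 'a) \<Rightarrow> ('a \<Rightarrow> real) \<Rightarrow> 'a \<Rightarrow> real" where
  "pl_extension \<Phi> \<omega> h =
     (THE f. pl_on_fan (coxeter_complex \<Phi>) f \<and> (\<forall>r\<in>weight_rays \<Phi> \<omega>. f r = h r))"

definition submodular ::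
    "'a::euclidean_space set \<Rightarrow> (nat \<Rightarrow> 'a) \<Rightarrow> ('a \<Rightarrow> real) \<Rightarrow> bool" where
  "submodular \<Phi> \<omega> h \<longleftrightarrow> convex_on UNIV (pl_extension \<Phi> \<omega> h)"

definition locally_submodular ::
    "'a::euclidean_space set \<Rightarrow> (nat \<Rightarrow> 'a) \<Rightarrow> (nat \<Rightarrow> 'a) \<Rightarrow> ('a \<Rightarrow> real) \<Rightarrow> bool" where
  "locally_submodular \<Phi> \<alpha> \<omega> h \<longleftrightarrow>
     (\<forall>w\<in>weyl_group \<Phi>. \<forall>i\<in>{1..DIM('a)}.
        h (w (\<omega> i)) + h (w (reflection (\<alpha> i) (\<omega> i)))
          \<ge> (\<Sum>j\<in>dynkin_neighbors \<alpha> i. - cartan_matrix \<alpha> j i * h (w (\<omega> j))))"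

definition globally_submodular ::
    "'a::euclidean_space set \<Rightarrow> (nat \<Rightarrow> 'a) \<Rightarrow> ('a \<Rightarrow> real) \<Rightarrow> bool" where
  "globally_submodular \<Phi> \<omega> h \<longleftrightarrow>
     (\<forall>r\<in>weight_rays \<Phi> \<omega>. \<forall>r'\<in>weight_rays \<Phi> \<omega>.
        h r + h r' \<ge> pl_extension \<Phi> \<omega> h (r + r'))"


subsection \<open>Deformations of the permutohedron\<close>

definition normal_cone :: "'a::euclidean_space set \<Rightarrow> 'a set \<Rightarrow> 'a set" where
  "normal_cone P F = {u. \<forall>x\<in>F. \<forall>y\<in>P. u \<bullet> y \<le> u \<bullet> x}"

definition normal_fan :: "'a::euclidean_space set \<Rightarrow> 'a set set" where
  "normal_fan P = {normal_cone P F | F. F face_of P \<and> F \<noteq> {}}"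

definition coarsens :: "'a::euclidean_space set set \<Rightarrow> 'a set set \<Rightarrow> bool" where
  "coarsens F G \<longleftrightarrow> \<Union>F = \<Union>G \<and> (\<forall>\<sigma>\<in>G. \<exists>\<tau>\<in>F. \<sigma> \<subseteq> \<tau>)"

text \<open>The permutohedron itself does not occur below: a deformation of it is by definition a polytope
  whose outer normal fan coarsens the Coxeter complex.\<close>

definition permutohedron_deformation ::
    "'a::euclidean_space set \<Rightarrow> 'a set \<Rightarrow> bool" where
  "permutohedron_deformation \<Phi> P \<longleftrightarrow>
     polytope P \<and> P \<noteq> {} \<and> coarsens (normal_fan P) (coxeter_complex \<Phi>)"

definition weight_polytope ::
    "'a::euclidean_space set \<Rightarrow> (nat \<Rightarrow> 'a) \<Rightarrow> ('a \<Rightarrow> real) \<Rightarrow> 'a set" where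
  "weight_polytope \<Phi> \<omega> h = {v. \<forall>r\<in>weight_rays \<Phi> \<omega>. r \<bullet> v \<le> h r}"

end

theory Submission
  imports Defs
begin

text \<open>
  On the chamber \<open>w D\<close> the piecewise linear extension of \<open>h\<close> is \<open>x \<bullet> v\<^sub>w\<close> for a vector \<open>v\<^sub>w\<close>, and
  all three submodularity conditions amount to: each functional \<open>x \<bullet> v\<^sub>w\<close> lies below the
  extension everywhere. The local condition says precisely that \<open>v\<^sub>w - v\<^sub>w\<^sub>s\<close>, for \<open>s = s\<^sub>i\<close>, is
  a nonnegative multiple of \<open>w \<alpha>\<^sub>i\<close>. Summing along a reduced word of \<open>x\<close> shows that
  \<open>v\<^sub>w - v\<^sub>w\<^sub>x\<close> lies in \<open>w\<close> applied to the cone of the simple roots, and so is nonnegative on \<open>w D\<close>.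
  The same induction over reduced words gives \<open>q - w q\<close> in that cone for \<open>q \<in> D\<close>, which is what
  makes the extension well defined. The \<open>v\<^sub>w\<close> are the vertices of the polytope of \<open>h\<close>; conversely
  a deformation recovers \<open>h\<close> as its support function.
\<close>

section \<open>Reflections and the Weyl group\<close>

lemma linear_reflection: "linear (reflection v)"
  by (rule linearI) (simp_all add: reflection_def algebra_simps add_divide_distrib
      inner_add_left scaleR_add_left)

lemma reflection_involution [simp]: "reflection v (reflection v x) = x"
  by (cases "v = 0") (simp_all add: reflection_def inner_diff_left)

lemma inner_reflection: "reflection v x \<bullet> reflection v y = x \<bullet> y"
  by (cases "v = 0")
    (simp_all add: reflection_def inner_diff_left inner_diff_right inner_commute field_simps)

lemma reflection_alt: "reflection v x = x - (x \<bullet> coroot v) *\<^sub>R v"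
  by (simp add: reflection_def coroot_def)

lemma reflection_coroot: "reflection v x = x - (x \<bullet> v) *\<^sub>R coroot v"
  by (simp add: reflection_def coroot_def)

lemma reflection_self: "reflection v v = - v"
  by (cases "v = 0") (simp_all add: reflection_def scaleR_2)

lemma reflection_minus: "reflection (- v) = reflection v"
  by (rule ext) (simp add: reflection_def)

lemma bij_reflection: "bij (reflection v)"
  by (rule o_bij[of "reflection v"]) (auto simp: fun_eq_iff)

lemma reflection_conjugate:
  assumes "linear w" "\<And>x y. w x \<bullet> w y = x \<bullet> y"
  shows "reflection (w v) (w x) = w (reflection v x)"
  using assms by (simp add: reflection_def linear_diff linear_scale)

section \<open>Composition in the group of bijections and its subgroup \<open>W\<close>\<close>

lemma mult_BijGroup_UNIV:
  "bij f \<Longrightarrow> bij g \<Longrightarrow> f \<otimes>\<^bsub>BijGroup UNIV\<^esub> g = f \<circ> g"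
  by (simp add: BijGroup_def Bij_def compose_def fun_eq_iff)

lemma one_BijGroup_UNIV: "\<one>\<^bsub>BijGroup UNIV\<^esub> = id"
  by (simp add: BijGroup_def fun_eq_iff)

lemma carrier_BijGroup_UNIV: "f \<in> carrier (BijGroup UNIV) \<longleftrightarrow> bij f"
  by (simp add: BijGroup_def Bij_def)

lemma inv_BijGroup_reflection:
  "inv\<^bsub>BijGroup UNIV\<^esub> (reflection v) = reflection v"
  by (intro group.inv_equality group_BijGroup)
    (auto simp: carrier_BijGroup_UNIV bij_reflection mult_BijGroup_UNIV one_BijGroup_UNIV fun_eq_iff)

lemma weyl_group_bij: "w \<in> weyl_group \<Phi> \<Longrightarrow> bij w"
  unfolding weyl_group_def carrier_BijGroup_UNIV[symmetric]
  by (erule group.generate_in_carrier[OF group_BijGroup, rotated])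
    (auto simp: carrier_BijGroup_UNIV bij_reflection)

lemma weyl_group_id: "id \<in> weyl_group \<Phi>"
  unfolding weyl_group_def using generate.one[of "BijGroup UNIV"]
  by (simp add: one_BijGroup_UNIV)

lemma weyl_group_comp:
  "v \<in> weyl_group \<Phi> \<Longrightarrow> w \<in> weyl_group \<Phi> \<Longrightarrow> v \<circ> w \<in> weyl_group \<Phi>"
  using generate.eng[of v "BijGroup UNIV" "reflection ` \<Phi>" w] weyl_group_bij[of v \<Phi>]
    weyl_group_bij[of w \<Phi>]
  by (simp add: weyl_group_def mult_BijGroup_UNIV)

lemma weyl_group_reflection: "\<beta> \<in> \<Phi> \<Longrightarrow> reflection \<beta> \<in> weyl_group \<Phi>"
  unfolding weyl_group_def by (intro generate.incl) auto

text \<open>The rule of \<open>generate\<close> for inverses of generators collapses into the one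
  for generators, because reflections are involutions.\<close>

lemma weyl_group_gen_induct [consumes 1, case_names id reflection comp]:
  assumes "w \<in> weyl_group \<Phi>"
    and "P id"
    and "\<And>\<beta>. \<beta> \<in> \<Phi> \<Longrightarrow> P (reflection \<beta>)"
    and "\<And>v w. v \<in> weyl_group \<Phi> \<Longrightarrow> w \<in> weyl_group \<Phi> \<Longrightarrow> P v \<Longrightarrow> P w \<Longrightarrow> P (v \<circ> w)"
  shows "P w"
  using assms(1)[unfolded weyl_group_def]
proof (induction rule: generate.induct)
  case (eng h1 h2)
  have "h1 \<in> weyl_group \<Phi>" "h2 \<in> weyl_group \<Phi>"
    using eng.hyps by (auto simp: weyl_group_def)
  then show ?case
    using eng.IH assms(4) by (simp add: mult_BijGroup_UNIV weyl_group_bij del: comp_apply)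
qed (auto simp only: one_BijGroup_UNIV inv_BijGroup_reflection assms)

lemma weyl_group_inverse:
  assumes "w \<in> weyl_group \<Phi>"
  shows "\<exists>w'\<in>weyl_group \<Phi>. (\<forall>x. w' (w x) = x) \<and> (\<forall>x. w (w' x) = x)"
  using assms
proof (induction rule: weyl_group_gen_induct)
  case id
  show ?case by (rule bexI[OF _ weyl_group_id]) simp
next
  case (reflection \<beta>)
  then show ?case by (intro bexI[OF _ weyl_group_reflection]) auto
next
  case (comp v w)
  then obtain v' w' where "v' \<in> weyl_group \<Phi>" "w' \<in> weyl_group \<Phi>"
    "\<forall>x. v' (v x) = x" "\<forall>x. v (v' x) = x" "\<forall>x. w' (w x) = x" "\<forall>x. w (w' x) = x"
    by blast
  then show ?case by (intro bexI[of _ "w' \<circ> v'"]) (auto intro: weyl_group_comp)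
qed

lemma weyl_group_linear: "w \<in> weyl_group \<Phi> \<Longrightarrow> linear w"
  by (induction rule: weyl_group_gen_induct)
    (simp_all only: linear_reflection linear_compose linear_id)

lemma weyl_group_inner: "w \<in> weyl_group \<Phi> \<Longrightarrow> w x \<bullet> w y = x \<bullet> y"
  by (induction arbitrary: x y rule: weyl_group_gen_induct) (auto simp: inner_reflection)

lemma weyl_group_root:
  assumes "root_system \<Phi>" "w \<in> weyl_group \<Phi>" "\<beta> \<in> \<Phi>"
  shows "w \<beta> \<in> \<Phi>"
  using assms(2,3)
proof (induction arbitrary: \<beta> rule: weyl_group_gen_induct)
  case (reflection \<gamma>)
  then show ?case using assms(1) unfolding root_system_def by blast
qed auto

text \<open>By linearity an element of the group is determined by its values on the spanning set
  \<Phi>, and it maps the finite set \<Phi> into itself.\<close>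

lemma finite_weyl_group:
  assumes "root_system \<Phi>"
  shows "finite (weyl_group \<Phi>)"
proof (rule inj_on_finite)
  show "inj_on (\<lambda>w. restrict w \<Phi>) (weyl_group \<Phi>)"
  proof (rule inj_onI, rule ext)
    fix v w x
    assume v: "v \<in> weyl_group \<Phi>" and w: "w \<in> weyl_group \<Phi>"
      and eq: "restrict v \<Phi> = restrict w \<Phi>"
    have "x \<in> span \<Phi>"
      using assms by (simp add: root_system_def)
    moreover have "v b = w b" if "b \<in> \<Phi>" for b
      using fun_cong[OF eq, of b] that by simp
    ultimately show "v x = w x"
      using linear_eq_on_span[OF weyl_group_linear[OF v] weyl_group_linear[OF w]] by blast
  qed
  show "(\<lambda>w. restrict w \<Phi>) ` weyl_group \<Phi> \<subseteq> \<Phi> \<rightarrow>\<^sub>E \<Phi>"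
    using weyl_group_root[OF assms] by auto
  show "finite (\<Phi> \<rightarrow>\<^sub>E \<Phi>)"
    using assms by (simp add: finite_PiE root_system_def)
qed

text \<open>Non-neighbors in the Dynkin diagram are given only by a bound on \<open>ord\<close>,
  which is 0 for elements of infinite order. Finiteness of the group excludes that value, so the
  order divides 2; a product of two involutions whose square is trivial is a commuting
  product.\<close>

lemma reflection_order_le_2:
  assumes "root_system \<Phi>" "\<beta> \<in> \<Phi>" "\<gamma> \<in> \<Phi>"
    and "group.ord (BijGroup UNIV) (reflection \<beta> \<circ> reflection \<gamma>) \<le> 2"
  shows "reflection \<beta> \<circ> reflection \<gamma> = reflection \<gamma> \<circ> reflection \<beta>"
proof -
  let ?G = "BijGroup (UNIV :: 'a set)"
  let ?a = "reflection \<beta> \<circ> reflection \<gamma>"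
  interpret group ?G by (rule group_BijGroup)
  have aW: "?a \<in> weyl_group \<Phi>"
    using assms by (intro weyl_group_comp weyl_group_reflection)
  then have a: "?a \<in> carrier ?G"
    by (simp add: carrier_BijGroup_UNIV weyl_group_bij)
  have pow: "?a [^]\<^bsub>?G\<^esub> n \<in> weyl_group \<Phi>" for n :: nat
  proof (induction n)
    case (Suc n)
    then show ?case
      using aW weyl_group_comp[OF Suc aW]
      by (simp only: nat_pow_Suc mult_BijGroup_UNIV weyl_group_bij)
  qed (simp only: nat_pow_0 one_BijGroup_UNIV weyl_group_id)
  have "finite (range (\<lambda>n::nat. ?a [^]\<^bsub>?G\<^esub> n))"
    by (rule finite_subset[OF _ finite_weyl_group[OF assms(1)]]) (use pow in blast)
  then have "\<not> inj (\<lambda>n::nat. ?a [^]\<^bsub>?G\<^esub> n)"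
    by (meson finite_imageD infinite_UNIV_nat)
  then obtain m n :: nat where mn: "m < n" and eq:  "?a [^]\<^bsub>?G\<^esub> m = ?a [^]\<^bsub>?G\<^esub> n"
    using linorder_injI by blast
  then have "?a [^]\<^bsub>?G\<^esub> (n - m) = \<one>\<^bsub>?G\<^esub>"
    by (intro pow_eq_div2[OF a] eq[symmetric])
  then have "ord ?a \<noteq> 0"
    using a \<open>m < n\<close> by (subst ord_eq_0) (auto intro!: exI[of _ "n - m"])
  then have "ord ?a dvd 2"
    using assms(4) by (cases "ord ?a = 1") (auto simp: le_Suc_eq numeral_2_eq_2)
  then have "?a [^]\<^bsub>?G\<^esub> (2::nat) = \<one>\<^bsub>?G\<^esub>"
    using pow_eq_id[OF a] by simp
  then have aa: "?a \<circ> ?a = id"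
    using aW by (simp add: numeral_2_eq_2 a mult_BijGroup_UNIV weyl_group_bij one_BijGroup_UNIV)
  \<comment> \<open>At this argument the inner copy of \<open>?a\<close> cancels to the identity by
    the involution rule.\<close>
  have "?a x = (reflection \<gamma> \<circ> reflection \<beta>) x" for x
    using fun_cong[OF aa, of "reflection \<gamma> (reflection \<beta> x)"] by simp
  then show ?thesis by blast
qed


section \<open>Simple roots and the length induction\<close>

text \<open>The index set is an opaque parameter so that the simplifier leaves membership in it alone.\<close>

locale based_root_system =
  fixes \<Phi> D :: "'a::euclidean_space set" and \<alpha> \<omega> :: "nat \<Rightarrow> 'a" and I :: "nat set"
  assumes root_system: "root_system \<Phi>"
    and chamber: "D \<in> chambers \<Phi>"
    and simple_roots: "simple_roots \<Phi> D \<alpha>"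
    and fundamental_weights: "fundamental_weights \<alpha> \<omega>"
    and I_eq: "I = {1..DIM('a)}"
begin

abbreviation W :: "('a \<Rightarrow> 'a) set" where "W \<equiv> weyl_group \<Phi>"
abbreviation s :: "nat \<Rightarrow> 'a \<Rightarrow> 'a" where "s i \<equiv> reflection (\<alpha> i)"

lemma finite_I [simp]: "finite I"
  by (simp add: I_eq)

lemma simple_in_roots: "i \<in> I \<Longrightarrow> \<alpha> i \<in> \<Phi>"
  using simple_roots by (auto simp: simple_roots_def I_eq)

lemma root_nonzero: "\<beta> \<in> \<Phi> \<Longrightarrow> \<beta> \<noteq> 0"
  using root_system by (auto simp: root_system_def)

lemma simple_norm_pos: "i \<in> I \<Longrightarrow> 0 < \<alpha> i \<bullet> \<alpha> i"
  using root_nonzero[OF simple_in_roots] by simp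

lemma s_in_W: "i \<in> I \<Longrightarrow> s i \<in> W"
  by (intro weyl_group_reflection simple_in_roots)

lemma root_minus: "\<beta> \<in> \<Phi> \<Longrightarrow> - \<beta> \<in> \<Phi>"
  using root_system by (auto simp: root_system_def)

lemma root_multiple:
  assumes "\<beta> \<in> \<Phi>" "c *\<^sub>R \<beta> \<in> \<Phi>"
  shows "c *\<^sub>R \<beta> = \<beta> \<or> c *\<^sub>R \<beta> = - \<beta>"
proof -
  have "c *\<^sub>R \<beta> \<in> \<Phi> \<inter> range (\<lambda>c. c *\<^sub>R \<beta>)"
    using assms by blast
  also have "\<dots> = {\<beta>, - \<beta>}"
    using root_system assms(1) by (simp add: root_system_def)
  finally show ?thesis by simp
qed

lemma weight_coroot: "i \<in> I \<Longrightarrow> j \<in> I \<Longrightarrow> \<omega> i \<bullet> coroot (\<alpha> j) = (if i = j then 1 else 0)"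
  using fundamental_weights by (auto simp: fundamental_weights_def I_eq)

lemma root_eq_coroot: "i \<in> I \<Longrightarrow> \<alpha> i = (\<alpha> i \<bullet> \<alpha> i / 2) *\<^sub>R coroot (\<alpha> i)"
  using simple_norm_pos[of i] by (auto simp: coroot_def)

lemma simple_root_eq:
  assumes "i \<in> I"
  obtains k :: real where "0 < k" "\<alpha> i = k *\<^sub>R coroot (\<alpha> i)"
  using root_eq_coroot[OF assms] simple_norm_pos[OF assms] half_gt_zero by blast

lemma root_weight: "i \<in> I \<Longrightarrow> j \<in> I \<Longrightarrow> \<alpha> i \<bullet> \<omega> j = (if i = j then \<alpha> i \<bullet> \<alpha> i / 2 else 0)"
  by (subst root_eq_coroot) (auto simp: weight_coroot inner_commute[of "coroot _"])

text \<open>Both sides are linear in \<open>x\<close> and agree on the basis of weights.\<close>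

lemma weight_expansion: "(\<Sum>i\<in>I. (x \<bullet> coroot (\<alpha> i)) *\<^sub>R \<omega> i) = x"
proof -
  have inj: "inj_on \<omega> I" and "x \<in> span (\<omega> ` I)"
    using fundamental_weights by (auto simp: fundamental_weights_def I_eq)
  have lin: "linear (\<lambda>x. \<Sum>i\<in>I. (x \<bullet> coroot (\<alpha> i)) *\<^sub>R \<omega> i)"
    by (rule linearI) (simp_all add: inner_add_left scaleR_add_left sum.distrib scaleR_sum_right)
  have "(\<Sum>i\<in>I. (b \<bullet> coroot (\<alpha> i)) *\<^sub>R \<omega> i) = id b" if b: "b \<in> \<omega> ` I" for b
  proof -
    obtain j where j: "j \<in> I" "b = \<omega> j" using b by blast
    have "(\<Sum>i\<in>I. (b \<bullet> coroot (\<alpha> i)) *\<^sub>R \<omega> i) = (\<Sum>i\<in>I. if i = j then \<omega> j else 0)"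
      using j by (intro sum.cong) (auto simp: weight_coroot)
    then show ?thesis using j by simp
  qed
  then show ?thesis
    using linear_eq_on_span[OF lin linear_id, of "\<omega> ` I" x] \<open>x \<in> span (\<omega> ` I)\<close> by simp
qed

text \<open>The left side is the adjoint of the map in \<open>weight_expansion\<close>, hence of the
  identity.\<close>

lemma coroot_expansion: "(\<Sum>i\<in>I. (x \<bullet> \<omega> i) *\<^sub>R coroot (\<alpha> i)) = x"
proof -
  have "(\<Sum>i\<in>I. (x \<bullet> \<omega> i) *\<^sub>R coroot (\<alpha> i)) \<bullet> y = x \<bullet> (\<Sum>i\<in>I. (y \<bullet> coroot (\<alpha> i)) *\<^sub>R \<omega> i)" for y
    unfolding inner_sum_left inner_sum_right
    by (rule sum.cong) (simp_all add: inner_commute mult.commute)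
  then show ?thesis
    unfolding weight_expansion using vector_eq_rdot by blast
qed

lemma chamber_iff: "x \<in> D \<longleftrightarrow> (\<forall>i\<in>I. 0 \<le> x \<bullet> coroot (\<alpha> i))"
proof -
  have "x \<in> D \<longleftrightarrow> (\<forall>i\<in>I. 0 \<le> \<alpha> i \<bullet> x)"
    using simple_roots by (auto simp: simple_roots_def I_eq)
  moreover have "0 \<le> \<alpha> i \<bullet> x \<longleftrightarrow> 0 \<le> x \<bullet> coroot (\<alpha> i)" if "i \<in> I" for i
  proof -
    obtain k :: real where k: "0 < k" "\<alpha> i = k *\<^sub>R coroot (\<alpha> i)"
      using simple_root_eq[OF \<open>i \<in> I\<close>] by blast
    have "\<alpha> i \<bullet> x = k * (x \<bullet> coroot (\<alpha> i))"
      by (subst k(2)) (simp only: inner_scaleR_left inner_commute[of x])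
    then show ?thesis using k(1) by (simp add: zero_le_mult_iff)
  qed
  ultimately show ?thesis by blast
qed

section \<open>The dual cone of \<open>D\<close> and the positive roots\<close>

lemma weight_in_chamber: "i \<in> I \<Longrightarrow> \<omega> i \<in> D"
  by (simp add: chamber_iff weight_coroot)

text \<open>By \<open>coroot_expansion\<close> the numbers tested are the coordinates of
  \<open>v\<close> in the simple coroots. So this is the cone spanned by the simple roots, which is
  the dual cone of \<open>D\<close>; the roots in it are the positive roots.\<close>

definition pcone :: "'a set" where
  "pcone = {v. \<forall>i\<in>I. 0 \<le> v \<bullet> \<omega> i}"

lemma inner_chamber_pcone:
  assumes "x \<in> D" "v \<in> pcone"
  shows "0 \<le> x \<bullet> v"
proof -
  have "x \<bullet> v = (\<Sum>i\<in>I. (x \<bullet> coroot (\<alpha> i)) *\<^sub>R \<omega> i) \<bullet> v"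
    by (simp only: weight_expansion)
  also have "\<dots> \<ge> 0"
    unfolding inner_sum_left inner_scaleR_left
    using assms by (auto simp: pcone_def chamber_iff inner_commute[of "\<omega> _"] intro!: sum_nonneg)
  finally show ?thesis .
qed

lemma pcone_antisym:
  assumes "v \<in> pcone" "- v \<in> pcone"
  shows "v = 0"
proof -
  have "v \<bullet> \<omega> i = 0" if "i \<in> I" for i
    using assms that by (fastforce simp: pcone_def)
  then show ?thesis
    using coroot_expansion[of v] by simp
qed

lemma pcone_add: "u \<in> pcone \<Longrightarrow> v \<in> pcone \<Longrightarrow> u + v \<in> pcone"
  by (simp add: pcone_def inner_add_left)

lemma pcone_scale: "0 \<le> c \<Longrightarrow> v \<in> pcone \<Longrightarrow> c *\<^sub>R v \<in> pcone"
  by (simp add: pcone_def)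

lemma simple_in_pcone: "i \<in> I \<Longrightarrow> \<alpha> i \<in> pcone"
  by (simp add: pcone_def root_weight)

text \<open>\<open>D\<close> is the closure of a connected set on which \<beta> has no zero. By the
  intermediate value property \<beta> has a constant weak sign on \<open>D\<close>, in particular at
  all the weights.\<close>

lemma root_sign:
  assumes "\<beta> \<in> \<Phi>"
  shows "\<beta> \<in> pcone \<or> - \<beta> \<in> pcone"
proof -
  obtain K where K: "K \<in> components (UNIV - (\<Union>\<alpha>\<in>\<Phi>. {x. \<alpha> \<bullet> x = 0}))" "D = closure K"
    using chamber by (auto simp: chambers_def)
  have nz: "\<beta> \<bullet> x \<noteq> 0" if "x \<in> K" for x
    using in_components_subset[OF K(1)] that assms by blast
  have conn: "connected ((\<bullet>) \<beta> ` K)"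
    by (intro connected_continuous_image in_components_connected[OF K(1)] continuous_intros)
  have "(\<forall>x\<in>K. 0 \<le> \<beta> \<bullet> x) \<or> (\<forall>x\<in>K. \<beta> \<bullet> x \<le> 0)"
  proof (rule ccontr)
    assume "\<not> ?thesis"
    then obtain x y where xy: "x \<in> K" "y \<in> K" "\<beta> \<bullet> x < 0" "0 < \<beta> \<bullet> y"
      by (auto simp: not_le)
    then have "0 \<in> (\<bullet>) \<beta> ` K"
      using connectedD_interval[OF conn, of "\<beta> \<bullet> x" "\<beta> \<bullet> y" 0] by auto
    then show False using nz by force
  qed
  then have "K \<subseteq> {x. 0 \<le> \<beta> \<bullet> x} \<or> K \<subseteq> {x. \<beta> \<bullet> x \<le> 0}"
    by auto
  then have "D \<subseteq> {x. 0 \<le> \<beta> \<bullet> x} \<or> D \<subseteq> {x. \<beta> \<bullet> x \<le> 0}"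
    unfolding K(2) by (metis closure_minimal closed_halfspace_le closed_halfspace_ge)
  then show ?thesis
    using weight_in_chamber by (auto simp: pcone_def)
qed

lemma coroot_weight: "i \<in> I \<Longrightarrow> j \<in> I \<Longrightarrow> coroot (\<alpha> j) \<bullet> \<omega> i = (if i = j then 1 else 0)"
  using weight_coroot[of i j] by (simp add: inner_commute)

lemma inner_s_weight: "i \<in> I \<Longrightarrow> j \<in> I \<Longrightarrow> j \<noteq> i \<Longrightarrow> s i x \<bullet> \<omega> j = x \<bullet> \<omega> j"
  by (simp add: reflection_coroot inner_diff_left coroot_weight)

lemma s_weight: "i \<in> I \<Longrightarrow> j \<in> I \<Longrightarrow> s i (\<omega> j) = (if j = i then \<omega> i - \<alpha> i else \<omega> j)"
  by (simp add: reflection_alt weight_coroot)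

text \<open>\<open>s i\<close> changes only the coordinate at \<open>coroot (\<alpha> i)\<close>. If
  \<beta> is positive and its image negative, all other coordinates of \<beta> vanish, so \<beta> is
  a multiple of \<open>\<alpha> i\<close>.\<close>

lemma s_positive_root:
  assumes "\<beta> \<in> \<Phi>" "\<beta> \<in> pcone" "i \<in> I" "\<beta> \<noteq> \<alpha> i"
  shows "s i \<beta> \<in> pcone"
proof (rule ccontr)
  assume "s i \<beta> \<notin> pcone"
  then have neg: "- s i \<beta> \<in> pcone"
    using root_sign weyl_group_root[OF root_system s_in_W[OF assms(3)] assms(1)] by blast
  have "\<beta> \<bullet> \<omega> j = 0" if "j \<in> I" "j \<noteq> i" for j
    using neg assms(2) that inner_s_weight[OF assms(3) that, of \<beta>] by (fastforce simp: pcone_def)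
  then have "(\<Sum>j\<in>I. (\<beta> \<bullet> \<omega> j) *\<^sub>R coroot (\<alpha> j)) = (\<Sum>j\<in>I. if j = i then (\<beta> \<bullet> \<omega> i) *\<^sub>R coroot (\<alpha> i) else 0)"
    by (intro sum.cong) auto
  then have "\<beta> = (\<beta> \<bullet> \<omega> i) *\<^sub>R coroot (\<alpha> i)"
    using assms(3) by (simp add: coroot_expansion)
  then obtain c where "\<beta> = c *\<^sub>R \<alpha> i"
    by (metis coroot_def scaleR_scaleR)
  then have "\<beta> = - \<alpha> i"
    using root_multiple[OF simple_in_roots[OF assms(3)], of c] assms by auto
  then show False
    using assms(2) pcone_antisym[OF simple_in_pcone[OF assms(3)]]
      root_nonzero[OF simple_in_roots[OF assms(3)]] by auto
qed

text \<open>The root \<open>s i (\<alpha> j)\<close> is still positive, and its pairing with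
  \<open>\<omega> i\<close> is a negative multiple of the inner product in question.\<close>

lemma simple_inner_nonpos:
  assumes "i \<in> I" "j \<in> I" "i \<noteq> j"
  shows "coroot (\<alpha> i) \<bullet> \<alpha> j \<le> 0"
proof -
  have "\<alpha> j \<noteq> \<alpha> i"
    using assms root_weight[of j j] root_weight[of i j] simple_norm_pos[of j] by auto
  then have "s i (\<alpha> j) \<in> pcone"
    using assms s_positive_root simple_in_roots simple_in_pcone by blast
  then have "0 \<le> s i (\<alpha> j) \<bullet> \<omega> i"
    using assms by (simp add: pcone_def)
  then have "(coroot (\<alpha> i) \<bullet> \<alpha> j) * (\<alpha> i \<bullet> \<alpha> i) \<le> 0"
    using assms
    by (simp add: reflection_alt inner_diff_left root_weight inner_commute[of "coroot _"])
  then show ?thesis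
    using simple_norm_pos[OF assms(1)] by (metis mult_pos_pos not_le)
qed

section \<open>Words in the simple reflections\<close>

primrec word :: "nat list \<Rightarrow> 'a \<Rightarrow> 'a" where
  "word [] = id"
| "word (i # is) = s i \<circ> word is"

lemma word_append: "word (is @ js) = word is \<circ> word js"
  by (induction "is") (auto simp: fun_eq_iff)

lemma word_in_W: "set is \<subseteq> I \<Longrightarrow> word is \<in> W"
proof (induction "is")
  case (Cons i "is")
  then show ?case
    by (simp only: word.simps) (auto intro!: weyl_group_comp s_in_W simp del: comp_apply)
qed (simp only: word.simps weyl_group_id)

text \<open>The exchange condition. Apply the letters to \<open>\<alpha> i\<close> from the right:
  at some letter \<open>t\<close> the root turns from positive to negative, so just before it equals
  \<open>\<alpha> t\<close>. Conjugation then shows that appending \<open>s i\<close> amounts to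
  deleting that letter.\<close>

lemma exchange:
  assumes "set is \<subseteq> I" "i \<in> I" "word is (\<alpha> i) \<notin> pcone"
  shows "\<exists>js. length js < length is \<and> set js \<subseteq> I \<and> word js = word is \<circ> s i"
  using assms
proof (induction "is")
  case Nil
  then show ?case by (simp add: simple_in_pcone)
next
  case (Cons t us)
  show ?case
  proof (cases "word us (\<alpha> i) \<in> pcone")
    case False
    then obtain js where "length js < length us" "set js \<subseteq> I" "word js = word us \<circ> s i"
      using Cons.IH Cons.prems by (auto simp del: comp_apply)
    then show ?thesis
      using Cons.prems by (intro exI[of _ "t # js"]) (auto simp: fun_eq_iff)
  next
    case True
    have us: "word us \<in> W"
      using Cons.prems by (intro word_in_W) auto
    have eq: "word us (\<alpha> i) = \<alpha> t"
      using s_positive_root[OF weyl_group_root[OF root_system us simple_in_roots] True, of t]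
        Cons.prems by auto
    have "s t (word us (s i x)) = word us x" for x
      using reflection_conjugate[OF weyl_group_linear[OF us], of "\<alpha> i" "s i x"]
        weyl_group_inner[OF us] by (simp add: eq)
    then show ?thesis
      using Cons.prems by (intro exI[of _ us]) (auto simp: fun_eq_iff)
  qed
qed

text \<open>The list need not be reduced. When the last letter does not lengthen the product,
  \<open>exchange\<close> supplies a shorter list with the same product, so only lengthening steps
  have to be treated.\<close>

lemma word_induct:
  assumes "set is \<subseteq> I" "P id"
    and step: "\<And>u i. u \<in> W \<Longrightarrow> i \<in> I \<Longrightarrow> u (\<alpha> i) \<in> pcone \<Longrightarrow> P u \<Longrightarrow> P (u \<circ> s i)"
  shows "P (word is)"
  using assms(1)
proof (induction "is" rule: length_induct)
  case (1 "is")
  show ?case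
  proof (cases "is" rule: rev_cases)
    case Nil
    then show ?thesis using assms(2) by (simp only: word.simps)
  next
    case (snoc us i)
    then have us: "set us \<subseteq> I" "i \<in> I" and eq: "word is = word us \<circ> s i"
      using 1 by (auto simp: word_append fun_eq_iff)
    show ?thesis
    proof (cases "word us (\<alpha> i) \<in> pcone")
      case True
      then show ?thesis
        unfolding eq using step[of "word us" i] us 1 snoc word_in_W[of us] by (auto simp del: comp_apply)
    next
      case False
      then obtain js where "length js < length us" "set js \<subseteq> I" "word js = word us \<circ> s i"
        using exchange us by blast
      then show ?thesis
        using 1 snoc unfolding eq by (metis length_append less_trans trans_less_add1)
    qed
  qed
qed

text \<open>A point in the interior of \<open>D\<close>. Pairing with it serves as a height function
  on roots and as the functional that is maximized over orbits.\<close>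

definition \<rho> :: 'a where "\<rho> = (\<Sum>i\<in>I. \<omega> i)"

lemma rho_coroot: "i \<in> I \<Longrightarrow> \<rho> \<bullet> coroot (\<alpha> i) = 1"
  by (simp add: \<rho>_def inner_sum_left weight_coroot)

lemma rho_simple_pos: "i \<in> I \<Longrightarrow> 0 < \<rho> \<bullet> \<alpha> i"
  using root_eq_coroot[of i] rho_coroot[of i] simple_norm_pos[of i]
  by (metis inner_scaleR_right half_gt_zero mult.right_neutral)

text \<open>A root of least height in the orbit of \<open>\<beta>\<close> under the simple reflections is simple: otherwise
  some simple reflection keeps it positive and lowers its height.\<close>

lemma root_conjugate_simple:
  assumes "\<beta> \<in> \<Phi>" "\<beta> \<in> pcone"
  shows "\<exists>is i. set is \<subseteq> I \<and> i \<in> I \<and> word is (\<alpha> i) = \<beta>"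
proof -
  define S where "S = {\<gamma> \<in> \<Phi> \<inter> pcone. \<exists>is. set is \<subseteq> I \<and> word is \<gamma> = \<beta>}"
  have "finite S"
    using root_system by (simp add: S_def root_system_def)
  moreover have "\<beta> \<in> S"
    using assms by (auto simp: S_def intro!: exI[of _ "[]"])
  ultimately obtain \<gamma> where g: "\<gamma> \<in> S" and min: "\<And>\<delta>. \<delta> \<in> S \<Longrightarrow> \<rho> \<bullet> \<gamma> \<le> \<rho> \<bullet> \<delta>"
    using arg_min_if_finite(1)[of S "\<lambda>\<gamma>. \<rho> \<bullet> \<gamma>"] arg_min_least[of S _ "\<lambda>\<gamma>. \<rho> \<bullet> \<gamma>"] by blast
  obtain "is" where gi: "\<gamma> \<in> \<Phi>" "\<gamma> \<in> pcone" "set is \<subseteq> I" "word is \<gamma> = \<beta>"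
    using g by (auto simp: S_def)
  \<comment> \<open>Otherwise \<open>- \<gamma>\<close> would lie in \<open>D\<close>; as \<gamma>
    is in the dual cone, its norm would vanish.\<close>
  have "\<exists>i\<in>I. 0 < \<gamma> \<bullet> coroot (\<alpha> i)"
  proof (rule ccontr)
    assume "\<not> ?thesis"
    then have "- \<gamma> \<in> D"
      by (auto simp: chamber_iff not_less)
    then have "\<gamma> \<bullet> \<gamma> \<le> 0"
      using inner_chamber_pcone[OF _ gi(2), of "- \<gamma>"] by simp
    then show False
      using root_nonzero[OF gi(1)] by (metis inner_eq_zero_iff inner_ge_zero order_antisym)
  qed
  then obtain i where i: "i \<in> I" "0 < \<gamma> \<bullet> coroot (\<alpha> i)" by blast
  have "\<gamma> = \<alpha> i"
  proof (rule ccontr)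
    assume "\<gamma> \<noteq> \<alpha> i"
    then have "s i \<gamma> \<in> pcone" "s i \<gamma> \<in> \<Phi>"
      using s_positive_root gi i weyl_group_root[OF root_system s_in_W] by blast+
    then have "s i \<gamma> \<in> S"
      using gi i by (auto simp: S_def word_append intro!: exI[of _ "is @ [i]"])
    then have "(\<gamma> \<bullet> coroot (\<alpha> i)) * (\<rho> \<bullet> \<alpha> i) \<le> 0"
      using min by (fastforce simp: reflection_alt inner_diff_right)
    then show False
      using i rho_simple_pos[of i] by (simp add: mult_le_0_iff)
  qed
  then show ?thesis using gi i by blast
qed

text \<open>A positive root is \<open>u (\<alpha> i)\<close> for a word \<open>u\<close>, so its
  reflection is the conjugate of \<open>s i\<close> by \<open>u\<close>, and the inverse of
  \<open>u\<close> is the reversed word. A negative root has the same reflection as its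
  opposite.\<close>

lemma W_eq_words:
  assumes "w \<in> W"
  shows "\<exists>is. set is \<subseteq> I \<and> word is = w"
  using assms
proof (induction rule: weyl_group_gen_induct)
  case id
  show ?case by (rule exI[of _ "[]"]) auto
next
  case (reflection \<beta>)
  have pos: "\<exists>is. set is \<subseteq> I \<and> word is = reflection \<gamma>" if g: "\<gamma> \<in> \<Phi>" "\<gamma> \<in> pcone" for \<gamma>
  proof -
    obtain "is" i where i: "set is \<subseteq> I" "i \<in> I" "word is (\<alpha> i) = \<gamma>"
      using root_conjugate_simple[OF g] by blast
    have w: "word is \<in> W"
      using i by (intro word_in_W) auto
    have inv: "word (rev js) (word js x) = x" for js x
      by (induction js arbitrary: x) (auto simp: word_append)
    have inv': "word is (word (rev is) x) = x" for x
      using inv[of "rev is"] by simp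
    have "word (is @ [i] @ rev is) x = reflection \<gamma> x" for x
      using reflection_conjugate[OF weyl_group_linear[OF w], of "\<alpha> i" "word (rev is) x"]
        weyl_group_inner[OF w] by (simp add: word_append inv' i)
    then show ?thesis
      using i by (intro exI[of _ "is @ [i] @ rev is"]) auto
  qed
  show ?case
    using root_sign[OF reflection] pos[OF reflection] pos[OF root_minus[OF reflection]]
    by (auto simp: reflection_minus)
next
  case (comp v w)
  then show ?case by (metis word_append set_append le_sup_iff)
qed

text \<open>This is induction on the length of \<open>w\<close>: multiplication by \<open>s\<^sub>i\<close> on the right lengthens \<open>u\<close>
  exactly when \<open>u \<alpha>\<^sub>i\<close> is positive.\<close>

lemma weyl_induct [consumes 1, case_names id step]:
  assumes "w \<in> W" "P id"
    and "\<And>u i. u \<in> W \<Longrightarrow> i \<in> I \<Longrightarrow> u (\<alpha> i) \<in> pcone \<Longrightarrow> P u \<Longrightarrow> P (u \<circ> s i)"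
  shows "P w"
  using W_eq_words[OF assms(1)] word_induct[of _ P] assms(2,3) by blast

text \<open>A lengthening step from \<open>u\<close> to \<open>u \<circ> s i\<close> adds a multiple
  of the positive root \<open>u (\<alpha> i)\<close>, whose coefficient is nonnegative since
  \<open>q\<close> is in \<open>D\<close>.\<close>

lemma chamber_minus_orbit:
  assumes "w \<in> W" "q \<in> D"
  shows "q - w q \<in> pcone"
  using assms(1)
proof (induction rule: weyl_induct)
  case id
  show ?case by (simp add: pcone_def)
next
  case (step u i)
  have "q - (u \<circ> s i) q = (q - u q) + (q \<bullet> coroot (\<alpha> i)) *\<^sub>R u (\<alpha> i)"
    using weyl_group_linear[OF step(1)] by (simp add: reflection_alt linear_diff linear_scale)
  also have "\<dots> \<in> pcone"
    using step assms(2) by (intro pcone_add pcone_scale) (auto simp: chamber_iff)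
  finally show ?case .
qed


section \<open>The Coxeter complex\<close>

lemma chamber_cover: "\<exists>w\<in>W. q \<in> w ` D"
proof -
  \<comment> \<open>The orbit point of largest pairing with \<rho> lies in \<open>D\<close>: if it
    paired negatively with a simple coroot, the corresponding reflection would increase the
    value.\<close>
  obtain w where w: "w \<in> W" and max: "\<And>v. v \<in> W \<Longrightarrow> \<rho> \<bullet> v q \<le> \<rho> \<bullet> w q"
    using ex_min_if_finite[of "(\<lambda>w. - (\<rho> \<bullet> w q)) ` W"] finite_weyl_group[OF root_system]
      weyl_group_id[of \<Phi>] by (force simp: not_less)
  have "0 \<le> w q \<bullet> coroot (\<alpha> i)" if i: "i \<in> I" for i
  proof -
    have "\<rho> \<bullet> (s i \<circ> w) q \<le> \<rho> \<bullet> w q"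
      using i w by (intro max weyl_group_comp s_in_W)
    then have "0 \<le> (w q \<bullet> coroot (\<alpha> i)) * (\<rho> \<bullet> \<alpha> i)"
      by (simp add: reflection_alt inner_diff_right)
    then show ?thesis
      using rho_simple_pos[OF i] by (meson linorder_not_less mult_neg_pos)
  qed
  then have "w q \<in> D"
    by (simp add: chamber_iff)
  moreover obtain w' where w': "w' \<in> W" "\<And>y. w' (w y) = y" "\<And>y. w (w' y) = y"
    using weyl_group_inverse[OF w] by auto
  moreover have "q = w' (w q)" using w' by simp
  ultimately show ?thesis using w'(1) by blast
qed

text \<open>Applying \<open>chamber_minus_orbit\<close> to \<open>w\<close> and to its inverse puts
  both \<open>q - w q\<close> and its negative into the pointed cone \<open>pcone\<close>.\<close>

lemma orbit_meets_chamber_once: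
  assumes "w \<in> W" "q \<in> D" "w q \<in> D"
  shows "w q = q"
proof -
  obtain w' where w': "w' \<in> W" "\<And>y. w' (w y) = y" "\<And>y. w (w' y) = y"
    using weyl_group_inverse[OF assms(1)] by auto
  have "q - w q \<in> pcone" "w q - q \<in> pcone"
    using chamber_minus_orbit[OF assms(1,2)] chamber_minus_orbit[OF w'(1) assms(3)] w'(2) by simp_all
  then have "q - w q = 0"
    by (intro pcone_antisym) simp_all
  then show ?thesis by simp
qed

text \<open>The vectors \<open>\<omega>\<^sub>i - w \<omega>\<^sub>i\<close> lie in the pointed cone \<open>pcone\<close>; if a positive combination of
  them vanishes, so does each of them.\<close>

lemma weights_fixed:
  assumes "w \<in> W" "q \<in> D" "w q = q" "i \<in> I" "q \<bullet> coroot (\<alpha> i) \<noteq> 0"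
  shows "w (\<omega> i) = \<omega> i"
proof -
  let ?c = "\<lambda>j. q \<bullet> coroot (\<alpha> j)" and ?v = "\<lambda>j. \<omega> j - w (\<omega> j)"
  have lin: "linear w" by (rule weyl_group_linear[OF assms(1)])
  have v: "?v j \<in> pcone" if "j \<in> I" for j
    by (intro chamber_minus_orbit assms(1) weight_in_chamber that)
  have "w q = (\<Sum>j\<in>I. ?c j *\<^sub>R w (\<omega> j))"
    using arg_cong[OF weight_expansion[of q], of w] by (simp add: linear_sum[OF lin] linear_scale[OF lin])
  then have "(\<Sum>j\<in>I. ?c j *\<^sub>R ?v j) = 0"
    using assms(3) by (simp add: scaleR_diff_right sum_subtractf weight_expansion)
  \<comment> \<open>Pairing with \<rho>, the sum of all weights, turns the vector relation into a
    vanishing sum of nonnegative numbers.\<close>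
  then have "(\<Sum>j\<in>I. ?c j * (?v j \<bullet> \<rho>)) = 0"
    using inner_sum_left[of "\<lambda>j. ?c j *\<^sub>R ?v j" I \<rho>] by (simp only: inner_scaleR_left inner_zero_left)
  moreover have "0 \<le> ?c j * (?v j \<bullet> \<omega> k)" if "j \<in> I" "k \<in> I" for j k
    using v[OF that(1)] assms(2) that by (auto simp: chamber_iff pcone_def)
  moreover have "?v j \<bullet> \<rho> = (\<Sum>k\<in>I. ?v j \<bullet> \<omega> k)" for j
    by (simp add: \<rho>_def inner_sum_right)
  ultimately have "\<forall>j\<in>I. \<forall>k\<in>I. ?c j * (?v j \<bullet> \<omega> k) = 0"
    by (simp add: sum_distrib_left sum_nonneg sum_nonneg_eq_0_iff)
  then have "\<forall>k\<in>I. ?v i \<bullet> \<omega> k = 0"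
    using assms(4,5) by (meson mult_eq_0_iff)
  then have "?v i = 0"
    using coroot_expansion[of "?v i"] by simp
  then show ?thesis by simp
qed

text \<open>The linear functional that takes the value \<open>h (w \<omega>\<^sub>i)\<close> at \<open>w \<omega>\<^sub>i\<close> is \<open>\<lambda>x. x \<bullet> vert h w\<close>; for
  submodular \<open>h\<close> these vectors are the vertices of the weight polytope.\<close>

definition vert :: "('a \<Rightarrow> real) \<Rightarrow> ('a \<Rightarrow> 'a) \<Rightarrow> 'a" where
  "vert h w = (\<Sum>i\<in>I. h (w (\<omega> i)) *\<^sub>R w (coroot (\<alpha> i)))"

text \<open>A point may lie in several translates of \<open>D\<close>; by
  \<open>vert_consistent\<close> the choice does not affect the value.\<close>

definition ext :: "('a \<Rightarrow> real) \<Rightarrow> 'a \<Rightarrow> real" where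
  "ext h x = x \<bullet> vert h (SOME w. w \<in> W \<and> x \<in> w ` D)"

lemma inner_vert:
  assumes "w \<in> W"
  shows "w p \<bullet> vert h w = (\<Sum>i\<in>I. (p \<bullet> coroot (\<alpha> i)) * h (w (\<omega> i)))"
  by (simp add: vert_def inner_sum_right weyl_group_inner[OF assms] mult.commute)

lemma weight_vert: "w \<in> W \<Longrightarrow> i \<in> I \<Longrightarrow> w (\<omega> i) \<bullet> vert h w = h (w (\<omega> i))"
  by (simp add: inner_vert weight_coroot if_distrib[of "\<lambda>c. c * _"] cong: if_cong)

text \<open>The preimages of \<open>x\<close> in \<open>D\<close> under \<open>v\<close> and
  \<open>w\<close> coincide, since \<open>D\<close> meets each orbit once. By
  \<open>weights_fixed\<close>, \<open>v\<close> and \<open>w\<close> agree on every weight that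
  occurs in this preimage, and only these weights contribute to the value.\<close>

lemma vert_consistent:
  assumes "v \<in> W" "w \<in> W" "x \<in> v ` D" "x \<in> w ` D"
  shows "x \<bullet> vert h v = x \<bullet> vert h w"
proof -
  obtain p q where pq: "x = v p" "p \<in> D" "x = w q" "q \<in> D"
    using assms by blast
  obtain w' where w': "w' \<in> W" "\<And>y. w' (w y) = y" "\<And>y. w (w' y) = y"
    using weyl_group_inverse[OF assms(2)] by auto
  have u: "w' \<circ> v \<in> W"
    by (intro weyl_group_comp w' assms(1))
  have up: "(w' \<circ> v) p = q"
    using pq w' by (metis comp_apply)
  then have "p = q"
    using orbit_meets_chamber_once[OF u pq(2)] pq(4) by simp
  have "v (\<omega> i) = w (\<omega> i)" if "i \<in> I" "p \<bullet> coroot (\<alpha> i) \<noteq> 0" for i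
    using weights_fixed[OF u pq(2) _ that] up \<open>p = q\<close> w'(3) by (metis comp_apply)
  then have "(p \<bullet> coroot (\<alpha> i)) * h (v (\<omega> i)) = (p \<bullet> coroot (\<alpha> i)) * h (w (\<omega> i))" if "i \<in> I" for i
    using that by (metis mult_zero_left)
  then have "v p \<bullet> vert h v = w p \<bullet> vert h w"
    unfolding inner_vert[OF assms(1)] inner_vert[OF assms(2)] by (intro sum.cong) auto
  then show ?thesis
    using pq \<open>p = q\<close> by simp
qed

lemma ext_eq:
  assumes "w \<in> W" "x \<in> w ` D"
  shows "ext h x = x \<bullet> vert h w"
proof -
  let ?w = "SOME w. w \<in> W \<and> x \<in> w ` D"
  have "?w \<in> W \<and> x \<in> ?w ` D"
    using assms by (intro someI[of "\<lambda>w. w \<in> W \<and> x \<in> w ` D"]) blast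
  then show ?thesis
    unfolding ext_def using vert_consistent assms by blast
qed

lemma ext_weight: "w \<in> W \<Longrightarrow> i \<in> I \<Longrightarrow> ext h (w (\<omega> i)) = h (w (\<omega> i))"
  using ext_eq[of w "w (\<omega> i)" h] weight_in_chamber by (simp add: weight_vert)

lemma closed_chamber: "closed D"
  using chamber by (auto simp: chambers_def)

lemma convex_chamber: "convex D"
  by (auto simp: convex_alt chamber_iff inner_add_left)

text \<open>The space is a finite union of closed translates of \<open>D\<close>, and the function
  is linear on each of them.\<close>

lemma continuous_ext: "continuous_on UNIV (ext h)"
proof -
  have "closed (w ` D)" if "w \<in> W" for w
    using that weyl_group_bij[OF that] bij_is_inj
    by (intro closed_injective_linear_image closed_chamber weyl_group_linear) auto
  moreover have "continuous_on (w ` D) (ext h)" if "w \<in> W" for w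
    using continuous_on_cong[of "w ` D" "w ` D" "ext h" "\<lambda>x. x \<bullet> vert h w"] ext_eq[OF that]
    by (auto intro!: continuous_intros)
  ultimately have "continuous_on (\<Union>w\<in>W. w ` D) (ext h)"
    by (intro continuous_on_closed_Union finite_weyl_group[OF root_system]) auto
  moreover have "(\<Union>w\<in>W. w ` D) = UNIV"
    using chamber_cover by blast
  ultimately show ?thesis by simp
qed

section \<open>The chambers as the translates of \<open>D\<close>\<close>

definition regular :: "'a set" where
  "regular = UNIV - (\<Union>\<beta>\<in>\<Phi>. {x. \<beta> \<bullet> x = 0})"

definition open_chamber :: "'a set" where
  "open_chamber = {x. \<forall>i\<in>I. 0 < x \<bullet> coroot (\<alpha> i)}"

lemma regular_image:
  assumes "w \<in> W" "x \<in> regular"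
  shows "w x \<in> regular"
proof -
  obtain w' where w': "w' \<in> W" "\<And>y. w' (w y) = y" "\<And>y. w (w' y) = y"
    using weyl_group_inverse[OF assms(1)] by auto
  have "\<beta> \<bullet> w x \<noteq> 0" if "\<beta> \<in> \<Phi>" for \<beta>
    using weyl_group_root[OF root_system w'(1) that] assms(2) weyl_group_inner[OF w'(1), of \<beta> "w x"]
    by (auto simp: regular_def w'(2))
  then show ?thesis by (auto simp: regular_def)
qed

lemma convex_open_chamber: "convex open_chamber"
proof -
  have "open_chamber = (\<Inter>i\<in>I. {x. coroot (\<alpha> i) \<bullet> x > 0})"
    by (auto simp: open_chamber_def inner_commute)
  then show ?thesis by (simp add: convex_INT convex_halfspace_gt)
qed

lemma inner_open_chamber_pos:
  assumes "x \<in> open_chamber" "v \<in> pcone" "v \<noteq> 0"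
  shows "0 < x \<bullet> v"
proof -
  have "x \<bullet> v = (\<Sum>i\<in>I. (x \<bullet> coroot (\<alpha> i)) *\<^sub>R \<omega> i) \<bullet> v"
    by (simp only: weight_expansion)
  also have "\<dots> = (\<Sum>i\<in>I. (x \<bullet> coroot (\<alpha> i)) * (v \<bullet> \<omega> i))"
    by (simp only: inner_sum_left inner_scaleR_left inner_commute[of v])
  finally have eq: "x \<bullet> v = (\<Sum>i\<in>I. (x \<bullet> coroot (\<alpha> i)) * (v \<bullet> \<omega> i))" .
  obtain j where j: "j \<in> I" "v \<bullet> \<omega> j \<noteq> 0"
    using coroot_expansion[of v] assms(3) by (metis (no_types, lifting) scaleR_eq_0_iff sum.neutral)
  have "0 \<le> v \<bullet> \<omega> i" if "i \<in> I" for i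
    using assms that by (simp add: pcone_def)
  then show ?thesis
    unfolding eq using assms(1) j
    by (intro sum_pos2[of I j]) (auto simp: open_chamber_def less_le intro!: mult_pos_pos)
qed

lemma open_chamber_regular: "open_chamber \<subseteq> regular"
proof
  fix x assume x: "x \<in> open_chamber"
  have "\<beta> \<bullet> x \<noteq> 0" if "\<beta> \<in> \<Phi>" for \<beta>
    using root_sign[OF that] inner_open_chamber_pos[OF x, of \<beta>] inner_open_chamber_pos[OF x, of "- \<beta>"]
      root_nonzero[OF that] by (auto simp: inner_commute)
  then show "x \<in> regular" by (auto simp: regular_def)
qed

lemma chamber_regular: "x \<in> D \<Longrightarrow> x \<in> regular \<Longrightarrow> x \<in> open_chamber"
  using simple_in_roots
  by (fastforce simp: chamber_iff open_chamber_def regular_def coroot_def less_le inner_commute)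

lemma rho_open_chamber: "\<rho> \<in> open_chamber"
  by (simp add: open_chamber_def rho_coroot)

text \<open>The component whose closure is \<open>D\<close> consists of regular points of
  \<open>D\<close>, so it lies in \<open>open_chamber\<close>. Conversely
  \<open>open_chamber\<close> is connected and regular and meets the component, so maximality gives
  equality.\<close>

lemma open_chamber_component: "open_chamber \<in> components regular"
  and closure_open_chamber: "closure open_chamber = D"
proof -
  obtain K where K: "K \<in> components regular" "D = closure K"
    using chamber by (auto simp: chambers_def regular_def)
  have "K \<subseteq> open_chamber"
    using chamber_regular in_components_subset[OF K(1)] closure_subset[of K] K(2) by blast
  moreover from this have "open_chamber \<subseteq> K"
    using in_components_nonempty[OF K(1)]
    by (intro components_maximal[OF K(1)] convex_connected convex_open_chamber open_chamber_regular)
      blast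
  ultimately have "K = open_chamber" by blast
  then show "open_chamber \<in> components regular" "closure open_chamber = D"
    using K by simp_all
qed

text \<open>Both \<open>w\<close> and its inverse preserve regularity and connectedness; maximality
  of components gives one inclusion for each.\<close>

lemma component_eq:
  assumes "C \<in> components regular" "w \<in> W" "w y \<in> C" "y \<in> open_chamber"
  shows "C = w ` open_chamber"
proof
  obtain w' where w': "w' \<in> W" "\<And>y. w' (w y) = y" "\<And>y. w (w' y) = y"
    using weyl_group_inverse[OF assms(2)] by auto
  have cont: "continuous_on S v" if "v \<in> W" for v S
    by (intro linear_continuous_on weyl_group_linear[OF that] linear_conv_bounded_linear[THEN iffD1])
  have "w ` open_chamber \<subseteq> regular"
    using open_chamber_regular regular_image[OF assms(2)] by blast
  then show "w ` open_chamber \<subseteq> C"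
    using assms(3,4)
    by (intro components_maximal[OF assms(1)] connected_continuous_image cont[OF assms(2)]
        convex_connected convex_open_chamber) blast+
  have "w' ` C \<subseteq> regular"
    using in_components_subset[OF assms(1)] regular_image[OF w'(1)] by blast
  moreover have "y \<in> w' ` C"
    using assms(3) w'(2) by (metis imageI)
  ultimately have "w' ` C \<subseteq> open_chamber"
    using assms(4)
    by (intro components_maximal[OF open_chamber_component] connected_continuous_image
        cont[OF w'(1)] in_components_connected[OF assms(1)]) blast+
  then show "C \<subseteq> w ` open_chamber"
    by (metis image_subset_iff rev_image_eqI subsetI w'(3))
qed

lemma closure_image_open_chamber: "w \<in> W \<Longrightarrow> closure (w ` open_chamber) = w ` D"
  using closure_injective_linear_image[OF weyl_group_linear bij_is_inj[OF weyl_group_bij], of w \<Phi> \<Phi> open_chamber]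
    closure_open_chamber by simp

text \<open>Every component contains a point \<open>w y\<close> with \<open>y\<close> in
  \<open>D\<close>, and regularity moves \<open>y\<close> into \<open>open_chamber\<close>.
  Conversely \<open>w \<rho>\<close> is regular, so it lies in some component.\<close>

lemma chambers_eq: "chambers \<Phi> = (\<lambda>w. w ` D) ` W"
proof
  show "chambers \<Phi> \<subseteq> (\<lambda>w. w ` D) ` W"
  proof
    fix E assume "E \<in> chambers \<Phi>"
    then obtain C where C: "C \<in> components regular" "E = closure C"
      by (auto simp: chambers_def regular_def)
    then obtain x where x: "x \<in> C"
      using in_components_nonempty by blast
    obtain w y where w: "w \<in> W" "x = w y" "y \<in> D"
      using chamber_cover[of x] by blast
    obtain w' where w': "w' \<in> W" "\<And>y. w' (w y) = y" "\<And>y. w (w' y) = y"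
      using weyl_group_inverse[OF w(1)] by auto
    have "y \<in> open_chamber"
      using w regular_image[OF w'(1), of x] x in_components_subset[OF C(1)] w'(2)
      by (intro chamber_regular) auto
    then have "C = w ` open_chamber"
      using component_eq C w x by blast
    then show "E \<in> (\<lambda>w. w ` D) ` W"
      using C w closure_image_open_chamber by blast
  qed
  show "(\<lambda>w. w ` D) ` W \<subseteq> chambers \<Phi>"
  proof
    fix E assume "E \<in> (\<lambda>w. w ` D) ` W"
    then obtain w where w: "w \<in> W" "E = w ` D" by blast
    have "w \<rho> \<in> regular"
      using w rho_open_chamber open_chamber_regular regular_image by blast
    then obtain C where C: "C \<in> components regular" "w \<rho> \<in> C"
      using Union_components[of regular] by blast
    then have "C = w ` open_chamber"
      using component_eq w rho_open_chamber by blast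
    then show "E \<in> chambers \<Phi>"
      using C w closure_image_open_chamber unfolding chambers_def regular_def by blast
  qed
qed

lemma coxeter_complex_eq:
  "coxeter_complex \<Phi> = {\<sigma>. \<sigma> \<noteq> {} \<and> (\<exists>w\<in>W. \<sigma> face_of w ` D)}"
  by (simp add: coxeter_complex_def chambers_eq)

lemma chamber_in_complex:
  assumes "w \<in> W"
  shows "w ` D \<in> coxeter_complex \<Phi>"
proof -
  have "convex (w ` D)"
    by (intro convex_linear_image convex_chamber weyl_group_linear[OF assms])
  moreover have "D \<noteq> {}"
    using closure_open_chamber rho_open_chamber closure_subset by blast
  ultimately show ?thesis
    using assms face_of_refl[of "w ` D"] unfolding coxeter_complex_eq by blast
qed

lemma complex_subset_chamber:
  "\<sigma> \<in> coxeter_complex \<Phi> \<Longrightarrow> \<exists>w\<in>W. \<sigma> \<subseteq> w ` D"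
  by (auto simp: coxeter_complex_eq dest: face_of_imp_subset)

lemma Union_complex: "\<Union>(coxeter_complex \<Phi>) = UNIV"
  using chamber_cover chamber_in_complex by blast

section \<open>Existence and uniqueness of the piecewise linear extension\<close>

lemma weight_rays_eq: "weight_rays \<Phi> \<omega> = {w (\<omega> i) | w i. w \<in> W \<and> i \<in> I}"
  unfolding weight_rays_def I_eq by blast

text \<open>This gives uniqueness: the values at the rays of a chamber determine a function that is
  linear on the chamber.\<close>

lemma pl_on_fan_expand:
  assumes "pl_on_fan (coxeter_complex \<Phi>) f" "w \<in> W" "p \<in> D"
  shows "f (w p) = (\<Sum>i\<in>I. (p \<bullet> coroot (\<alpha> i)) * f (w (\<omega> i)))"
proof -
  have "\<exists>g. linear g \<and> (\<forall>x\<in>w ` D. f x = g x)"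
    using assms(1) chamber_in_complex[OF assms(2)] unfolding pl_on_fan_def by (elim conjE bspec)
  then obtain g where g: "linear g" "\<forall>x\<in>w ` D. f x = g x"
    by (elim exE conjE)
  have lin: "linear (g \<circ> w)"
    by (rule linear_compose[OF weyl_group_linear[OF assms(2)] g(1)])
  have "f (w p) = (g \<circ> w) (\<Sum>i\<in>I. (p \<bullet> coroot (\<alpha> i)) *\<^sub>R \<omega> i)"
    using g(2) assms(3) by (simp add: weight_expansion)
  also have "\<dots> = (\<Sum>i\<in>I. (p \<bullet> coroot (\<alpha> i)) * g (w (\<omega> i)))"
    unfolding linear_sum[OF lin] linear_scale[OF lin] by simp
  also have "\<dots> = (\<Sum>i\<in>I. (p \<bullet> coroot (\<alpha> i)) * f (w (\<omega> i)))"
    by (intro sum.cong) (simp_all add: g weight_in_chamber)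
  finally show ?thesis .
qed

lemma pl_ext: "pl_on_fan (coxeter_complex \<Phi>) (ext h)"
  unfolding pl_on_fan_def
proof (intro conjI continuous_ext ballI)
  fix \<sigma> assume "\<sigma> \<in> coxeter_complex \<Phi>"
  then obtain w where "w \<in> W" "\<sigma> \<subseteq> w ` D"
    using complex_subset_chamber by blast
  then show "\<exists>g. linear g \<and> (\<forall>x\<in>\<sigma>. ext h x = g x)"
    using ext_eq[of w _ h]
    by (intro exI[of _ "\<lambda>x. x \<bullet> vert h w"])
      (auto intro!: linearI simp: inner_add_left)
qed

lemma pl_unique:
  assumes "pl_on_fan (coxeter_complex \<Phi>) f" "\<And>r. r \<in> weight_rays \<Phi> \<omega> \<Longrightarrow> f r = h r"
  shows "f = ext h"
proof
  fix x
  obtain w p where w: "w \<in> W" "x = w p" "p \<in> D"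
    using chamber_cover[of x] by blast
  have "f (w (\<omega> i)) = h (w (\<omega> i))" if "i \<in> I" for i
    using assms(2) w that by (auto simp: weight_rays_eq)
  then show "f x = ext h x"
    using w by (simp add: pl_on_fan_expand[OF assms(1)] ext_eq inner_vert)
qed

lemma pl_extension_eq: "pl_extension \<Phi> \<omega> h = ext h"
  unfolding pl_extension_def
  by (rule the_equality) (auto simp: pl_ext weight_rays_eq ext_weight intro: pl_unique)


section \<open>Submodularity\<close>

lemma ext_ray: "r \<in> weight_rays \<Phi> \<omega> \<Longrightarrow> ext h r = h r"
  by (auto simp: weight_rays_eq ext_weight)

text \<open>The two reflections commute; evaluating both products at \<open>\<alpha> i\<close> and
  comparing the coordinates at \<open>\<omega> j\<close> forces the entry to vanish.\<close>

lemma non_neighbor_cartan_zero: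
  assumes "i \<in> I" "j \<in> I" "j \<noteq> i" "j \<notin> dynkin_neighbors \<alpha> i"
  shows "cartan_matrix \<alpha> j i = 0"
proof -
  let ?a = "\<alpha> i \<bullet> coroot (\<alpha> j)" and ?b = "\<alpha> j \<bullet> coroot (\<alpha> i)"
  have "coxeter_matrix \<alpha> i j \<le> 2"
    using assms by (auto simp: dynkin_neighbors_def I_eq)
  then have "s i \<circ> s j = s j \<circ> s i"
    using assms simple_in_roots
    by (intro reflection_order_le_2[OF root_system]) (auto simp: coxeter_matrix_def)
  then have "s i (s j (\<alpha> i)) = s j (s i (\<alpha> i))"
    by (metis comp_apply)
  then have "- \<alpha> i - ?a *\<^sub>R \<alpha> j + (?a * ?b) *\<^sub>R \<alpha> i = - \<alpha> i + ?a *\<^sub>R \<alpha> j"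
    by (simp add: reflection_self linear_diff[OF linear_reflection] linear_scale[OF linear_reflection]
        linear_neg[OF linear_reflection] reflection_alt[of "\<alpha> j" "\<alpha> i"] reflection_alt[of "\<alpha> i" "\<alpha> j"]
        algebra_simps)
  then have "(- \<alpha> i - ?a *\<^sub>R \<alpha> j + (?a * ?b) *\<^sub>R \<alpha> i) \<bullet> \<omega> j = (- \<alpha> i + ?a *\<^sub>R \<alpha> j) \<bullet> \<omega> j"
    by (rule arg_cong)
  then have "?a * (\<alpha> j \<bullet> \<alpha> j) = 0"
    using assms by (simp add: inner_add_left inner_diff_left root_weight)
  then show ?thesis
    using simple_norm_pos[OF assms(2)] by (simp add: cartan_matrix_def inner_commute)
qed

text \<open>The slack in the local inequality. The sum runs over all indices other than
  \<open>i\<close>, which is harmless because the Cartan entries at non-neighbors are 0.\<close>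

definition defect :: "('a \<Rightarrow> real) \<Rightarrow> ('a \<Rightarrow> 'a) \<Rightarrow> nat \<Rightarrow> real" where
  "defect h w i = h (w (\<omega> i)) + h (w (s i (\<omega> i))) -
     (\<Sum>j\<in>I - {i}. - cartan_matrix \<alpha> j i * h (w (\<omega> j)))"

lemma locally_submodular_iff:
  "locally_submodular \<Phi> \<alpha> \<omega> h \<longleftrightarrow> (\<forall>w\<in>W. \<forall>i\<in>I. 0 \<le> defect h w i)"
proof -
  have "(\<Sum>j\<in>dynkin_neighbors \<alpha> i. - cartan_matrix \<alpha> j i * h (w (\<omega> j))) =
      (\<Sum>j\<in>I - {i}. - cartan_matrix \<alpha> j i * h (w (\<omega> j)))" if "i \<in> I" for w i
  proof (intro sum.mono_neutral_left ballI)
    show "dynkin_neighbors \<alpha> i \<subseteq> I - {i}"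
      by (auto simp: dynkin_neighbors_def I_eq)
  qed (use non_neighbor_cartan_zero[OF that] in auto)
  then show ?thesis
    unfolding locally_submodular_def I_eq[symmetric] by (simp add: defect_def)
qed

text \<open>The coefficients of \<open>\<alpha> i\<close> in the weights are the Cartan entries of
  column \<open>i\<close>, with diagonal entry 2. This is the linear relation among the rays of two
  adjacent chambers.\<close>

lemma weight_plus_reflected:
  assumes "i \<in> I"
  shows "\<omega> i + s i (\<omega> i) = (\<Sum>j\<in>I - {i}. (- cartan_matrix \<alpha> j i) *\<^sub>R \<omega> j)"
proof -
  have "\<alpha> i = (\<Sum>j\<in>I. cartan_matrix \<alpha> j i *\<^sub>R \<omega> j)"
    using weight_expansion[of "\<alpha> i"] by (simp add: cartan_matrix_def inner_commute)
  moreover have "cartan_matrix \<alpha> i i = 2"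
    using simple_norm_pos[OF assms] by (simp add: cartan_matrix_def coroot_def)
  ultimately have "\<alpha> i = 2 *\<^sub>R \<omega> i + (\<Sum>j\<in>I - {i}. cartan_matrix \<alpha> j i *\<^sub>R \<omega> j)"
    using assms by (simp add: sum.remove)
  moreover have "\<omega> i + s i (\<omega> i) = 2 *\<^sub>R \<omega> i - \<alpha> i"
    using assms by (simp add: s_weight scaleR_2)
  ultimately show ?thesis
    by (simp add: sum_negf)
qed

lemma weyl_coroot_expansion:
  assumes "w \<in> W"
  shows "(\<Sum>j\<in>I. (x \<bullet> w (\<omega> j)) *\<^sub>R w (coroot (\<alpha> j))) = x"
proof -
  obtain w' where w': "w' \<in> W" "\<And>y. w (w' y) = y"
    using weyl_group_inverse[OF assms] by auto
  have lin: "linear w" by (rule weyl_group_linear[OF assms])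
  have "x \<bullet> w (\<omega> j) = w' x \<bullet> \<omega> j" for j
    using weyl_group_inner[OF assms, of "w' x" "\<omega> j"] by (simp add: w')
  then have "(\<Sum>j\<in>I. (x \<bullet> w (\<omega> j)) *\<^sub>R w (coroot (\<alpha> j))) =
      w (\<Sum>j\<in>I. (w' x \<bullet> \<omega> j) *\<^sub>R coroot (\<alpha> j))"
    by (simp add: linear_sum[OF lin] linear_scale[OF lin])
  then show ?thesis
    by (simp add: coroot_expansion w')
qed

lemma vert_eqI:
  assumes "w \<in> W" "\<And>i. i \<in> I \<Longrightarrow> w (\<omega> i) \<bullet> v = h (w (\<omega> i))"
  shows "vert h w = v"
  using weyl_coroot_expansion[OF assms(1), of v] assms(2)
  by (simp add: vert_def inner_commute)

text \<open>The chambers of \<open>w\<close> and \<open>w \<circ> s i\<close> share the rays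
  \<open>w (\<omega> j)\<close> with \<open>j\<close> different from \<open>i\<close>, so the two
  vectors differ by a multiple of \<open>w (coroot (\<alpha> i))\<close>. The relation
  \<open>weight_plus_reflected\<close> identifies the factor as the defect.\<close>

lemma vert_wall:
  assumes "w \<in> W" "i \<in> I"
  shows "vert h w = vert h (w \<circ> s i) + defect h w i *\<^sub>R w (coroot (\<alpha> i))"
proof (rule vert_eqI[OF assms(1)])
  let ?v = "vert h (w \<circ> s i)"
  have lin: "linear w" by (rule weyl_group_linear[OF assms(1)])
  have ws: "w \<circ> s i \<in> W"
    by (intro weyl_group_comp s_in_W assms)
  have vj: "w (\<omega> j) \<bullet> ?v = h (w (\<omega> j))" if "j \<in> I" "j \<noteq> i" for j
    using weight_vert[OF ws that(1), of h] that assms(2) by (simp add: s_weight)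
  have vi: "w (s i (\<omega> i)) \<bullet> ?v = h (w (s i (\<omega> i)))"
    using weight_vert[OF ws assms(2), of h] by simp
  have "w (\<omega> i) \<bullet> ?v + w (s i (\<omega> i)) \<bullet> ?v = w (\<omega> i + s i (\<omega> i)) \<bullet> ?v"
    by (simp add: linear_add[OF lin] inner_add_left)
  also have "\<dots> = (\<Sum>j\<in>I - {i}. - cartan_matrix \<alpha> j i * (w (\<omega> j) \<bullet> ?v))"
    unfolding weight_plus_reflected[OF assms(2)]
    by (simp add: linear_sum[OF lin] linear_scale[OF lin] linear_neg[OF lin] inner_sum_left)
  also have "\<dots> = (\<Sum>j\<in>I - {i}. - cartan_matrix \<alpha> j i * h (w (\<omega> j)))"
    by (intro sum.cong) (auto simp: vj)
  finally have i: "h (w (\<omega> i)) = w (\<omega> i) \<bullet> ?v + defect h w i"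
    by (simp add: defect_def vi)
  fix k assume "k \<in> I"
  then show "w (\<omega> k) \<bullet> (?v + defect h w i *\<^sub>R w (coroot (\<alpha> i))) = h (w (\<omega> k))"
    using assms by (cases "k = i")
      (simp_all add: inner_add_right weyl_group_inner[OF assms(1)] weight_coroot vj i)
qed

section \<open>Equivalence of the three conditions\<close>

definition dominated :: "('a \<Rightarrow> real) \<Rightarrow> bool" where
  "dominated h \<longleftrightarrow> (\<forall>w\<in>W. \<forall>u. u \<bullet> vert h w \<le> ext h u)"

lemma locally_submodular_dominated:
  assumes "locally_submodular \<Phi> \<alpha> \<omega> h"
  shows "dominated h"
  unfolding dominated_def
proof (intro ballI allI)
  fix w u assume w: "w \<in> W"
  obtain v p where v: "v \<in> W" "u = v p" "p \<in> D"
    using chamber_cover[of u] by blast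
  obtain v' where v': "v' \<in> W" "\<And>y. v (v' y) = y"
    using weyl_group_inverse[OF v(1)] by auto
  \<comment> \<open>Start at the chamber of \<open>u\<close> and move away from it. A lengthening
    step subtracts a nonnegative multiple of \<open>v (x (coroot (\<alpha> i)))\<close>, which pairs
    nonnegatively with \<open>v p\<close>. The case needed is the inverse of \<open>v\<close>
    composed with \<open>w\<close>.\<close>
  have "v p \<bullet> vert h (v \<circ> x) \<le> v p \<bullet> vert h v" if "x \<in> W" for x
    using that
  proof (induction rule: weyl_induct)
    case id
    show ?case by simp
  next
    case (step x i)
    obtain k :: real where k: "0 < k" "\<alpha> i = k *\<^sub>R coroot (\<alpha> i)"
      using simple_root_eq[OF step(2)] by blast
    have vx: "v \<circ> x \<in> W"
      by (intro weyl_group_comp v step)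
    have "x (coroot (\<alpha> i)) = (1 / k) *\<^sub>R x (\<alpha> i)"
      using k by (metis linear_scale[OF weyl_group_linear[OF step(1)]] divide_self_if less_irrefl
          scaleR_one scaleR_scaleR times_divide_eq_left mult_1)
    then have "x (coroot (\<alpha> i)) \<in> pcone"
      using k step(3) by (simp add: pcone_scale)
    then have "0 \<le> v p \<bullet> v (x (coroot (\<alpha> i)))"
      using v by (simp add: weyl_group_inner inner_chamber_pcone)
    moreover have "0 \<le> defect h (v \<circ> x) i"
      using assms vx step(2) unfolding locally_submodular_iff by blast
    ultimately have "0 \<le> defect h (v \<circ> x) i * (v p \<bullet> v (x (coroot (\<alpha> i))))"
      by simp
    moreover have "v p \<bullet> vert h (v \<circ> x) =
        v p \<bullet> vert h (v \<circ> x \<circ> s i) + defect h (v \<circ> x) i * (v p \<bullet> v (x (coroot (\<alpha> i))))"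
      by (subst vert_wall[OF vx step(2)]) (simp add: inner_add_right)
    ultimately have "v p \<bullet> vert h (v \<circ> x \<circ> s i) \<le> v p \<bullet> vert h (v \<circ> x)"
      by linarith
    then show ?case
      using step(4) by (simp only: comp_assoc)
  qed
  from this[of "v' \<circ> w"] have "v p \<bullet> vert h (v \<circ> (v' \<circ> w)) \<le> v p \<bullet> vert h v"
    using v' w by (simp only: weyl_group_comp)
  moreover have "v \<circ> (v' \<circ> w) = w"
    by (rule ext) (simp add: v')
  ultimately have "u \<bullet> vert h w \<le> u \<bullet> vert h v"
    using v by (simp only:)
  then show "u \<bullet> vert h w \<le> ext h u"
    using ext_eq v by (metis imageI)
qed

text \<open>Under domination \<open>ext h\<close> is the pointwise maximum of the functionals given
  by the vectors \<open>vert h w\<close>.\<close>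

lemma dominated_submodular:
  assumes "dominated h"
  shows "submodular \<Phi> \<omega> h"
  unfolding submodular_def pl_extension_eq
proof (rule convex_onI)
  fix t :: real and x y :: 'a assume t: "0 < t" "t < 1"
  let ?z = "(1 - t) *\<^sub>R x + t *\<^sub>R y"
  obtain w where w: "w \<in> W" "?z \<in> w ` D"
    using chamber_cover by blast
  have "ext h ?z = (1 - t) * (x \<bullet> vert h w) + t * (y \<bullet> vert h w)"
    using ext_eq[OF w] by (simp add: inner_add_left)
  also have "\<dots> \<le> (1 - t) * ext h x + t * ext h y"
    using assms t w by (intro add_mono mult_left_mono) (auto simp: dominated_def)
  finally show "ext h ?z \<le> (1 - t) * ext h x + t * ext h y" .
qed simp

text \<open>A convex function lies above its linearization at an interior point of a cone of linearity.\<close>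

lemma submodular_dominated:
  assumes "submodular \<Phi> \<omega> h"
  shows "dominated h"
  unfolding dominated_def
proof (intro ballI allI)
  fix w u assume w: "w \<in> W"
  have conv: "convex_on UNIV (ext h)"
    using assms by (simp add: submodular_def pl_extension_eq)
  obtain w' where w': "w' \<in> W" "\<And>y. w (w' y) = y"
    using weyl_group_inverse[OF w] by auto
  let ?q = "w' u"
  define M where "M = Max ((\<lambda>i. \<bar>?q \<bullet> coroot (\<alpha> i)\<bar>) ` I)"
  have M: "\<bar>?q \<bullet> coroot (\<alpha> i)\<bar> \<le> M" if "i \<in> I" for i
    using that by (simp add: M_def)
  have "0 \<le> M"
    using M[of 1] by (force simp: I_eq)
  \<comment> \<open>Small enough that \<open>?p\<close> stays in \<open>D\<close>: its pairing with
    each simple coroot is at least \<open>1 - t - t * M\<close>.\<close>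
  define t where "t = 1 / (2 + M)"
  have t: "0 < t" "t < 1" "t * (1 + M) \<le> 1"
    using \<open>0 \<le> M\<close> by (auto simp: t_def field_simps)
  let ?p = "(1 - t) *\<^sub>R \<rho> + t *\<^sub>R ?q"
  have "0 \<le> ?p \<bullet> coroot (\<alpha> i)" if "i \<in> I" for i
  proof -
    have "t * (- M) \<le> t * (?q \<bullet> coroot (\<alpha> i))"
      using M[OF that] t by (intro mult_left_mono) auto
    then show ?thesis
      using t(3) rho_coroot[OF that] by (simp add: inner_add_left algebra_simps)
  qed
  then have "?p \<in> D" "\<rho> \<in> D"
    by (auto simp: chamber_iff rho_coroot)
  then have "w ?p \<in> w ` D" "w \<rho> \<in> w ` D"
    by blast+
  then have eqs: "ext h (w ?p) = w ?p \<bullet> vert h w" "ext h (w \<rho>) = w \<rho> \<bullet> vert h w"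
    using ext_eq[OF w] by blast+
  have wp: "w ?p = (1 - t) *\<^sub>R w \<rho> + t *\<^sub>R u"
    using weyl_group_linear[OF w] w'(2) by (simp add: linear_add linear_scale)
  have "ext h (w ?p) \<le> (1 - t) * ext h (w \<rho>) + t * ext h u"
    unfolding wp using t by (intro convex_onD[OF conv]) auto
  then have "t * (u \<bullet> vert h w) \<le> t * ext h u"
    unfolding eqs unfolding wp by (simp add: inner_add_left)
  then show "u \<bullet> vert h w \<le> ext h u"
    using t by simp
qed

lemma dominated_globally_submodular:
  assumes "dominated h"
  shows "globally_submodular \<Phi> \<omega> h"
  unfolding globally_submodular_def pl_extension_eq
proof (intro ballI)
  fix r r' assume r: "r \<in> weight_rays \<Phi> \<omega>" "r' \<in> weight_rays \<Phi> \<omega>"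
  obtain w where w: "w \<in> W" "r + r' \<in> w ` D"
    using chamber_cover by blast
  have "ext h (r + r') = r \<bullet> vert h w + r' \<bullet> vert h w"
    using ext_eq[OF w] by (simp add: inner_add_left)
  also have "\<dots> \<le> ext h r + ext h r'"
    using assms w by (intro add_mono) (auto simp: dominated_def)
  also have "\<dots> = h r + h r'"
    using r by (simp add: ext_ray)
  finally show "ext h (r + r') \<le> h r + h r'" .
qed

text \<open>Apply the global condition to the rays \<open>w (\<omega> i)\<close> and
  \<open>w (s i (\<omega> i))\<close>. Their sum lies in \<open>w D\<close> because off-diagonal
  Cartan entries are nonpositive, so the extension at the sum is the right side of the local
  inequality.\<close>

lemma globally_submodular_locally:
  assumes "globally_submodular \<Phi> \<omega> h"
  shows "locally_submodular \<Phi> \<alpha> \<omega> h"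
  unfolding locally_submodular_iff
proof (intro ballI)
  fix w i assume wi: "w \<in> W" "i \<in> I"
  define p where "p = (\<Sum>j\<in>I - {i}. (- cartan_matrix \<alpha> j i) *\<^sub>R \<omega> j)"
  have lin: "linear w" by (rule weyl_group_linear[OF wi(1)])
  have ws: "w \<circ> s i \<in> W"
    by (intro weyl_group_comp s_in_W wi)
  have pc: "p \<bullet> coroot (\<alpha> k) = (if k = i then 0 else - cartan_matrix \<alpha> k i)" if "k \<in> I" for k
  proof -
    have "p \<bullet> coroot (\<alpha> k) =
        (\<Sum>j\<in>I - {i}. if j = k then - cartan_matrix \<alpha> k i else 0)"
      unfolding p_def inner_sum_left using that by (intro sum.cong) (auto simp: weight_coroot)
    then show ?thesis using that by simp
  qed
  have "p \<in> D"
    using pc wi(2) simple_inner_nonpos by (auto simp: chamber_iff cartan_matrix_def)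
  then have "ext h (w p) = w p \<bullet> vert h w"
    by (intro ext_eq wi) auto
  also have "\<dots> = (\<Sum>j\<in>I. (p \<bullet> coroot (\<alpha> j)) * h (w (\<omega> j)))"
    by (rule inner_vert[OF wi(1)])
  also have "\<dots> = (\<Sum>j\<in>I - {i}. - cartan_matrix \<alpha> j i * h (w (\<omega> j)))"
    using wi(2) by (intro sum.mono_neutral_cong_right) (auto simp: pc)
  finally have wp: "ext h (w p) = (\<Sum>j\<in>I - {i}. - cartan_matrix \<alpha> j i * h (w (\<omega> j)))" .
  moreover have "w (\<omega> i) \<in> weight_rays \<Phi> \<omega>"
    unfolding weight_rays_eq using wi by blast
  moreover have "w (s i (\<omega> i)) \<in> weight_rays \<Phi> \<omega>"
    unfolding weight_rays_eq using wi(2) ws by (auto intro!: exI[of _ "w \<circ> s i"] exI[of _ i])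
  ultimately have "ext h (w (\<omega> i) + w (s i (\<omega> i))) \<le> h (w (\<omega> i)) + h (w (s i (\<omega> i)))"
    using assms by (simp add: globally_submodular_def pl_extension_eq)
  moreover note wp
  moreover have "w (\<omega> i) + w (s i (\<omega> i)) = w p"
    using weight_plus_reflected[OF wi(2)] linear_add[OF lin] unfolding p_def by metis
  ultimately show "0 \<le> defect h w i"
    by (simp add: defect_def)
qed

lemma submodular_iff_dominated: "submodular \<Phi> \<omega> h \<longleftrightarrow> dominated h"
  using dominated_submodular submodular_dominated by blast

lemma locally_submodular_iff_dominated: "locally_submodular \<Phi> \<alpha> \<omega> h \<longleftrightarrow> dominated h"
  using locally_submodular_dominated dominated_globally_submodular globally_submodular_locally
  by blast

lemma globally_submodular_iff_dominated: "globally_submodular \<Phi> \<omega> h \<longleftrightarrow> dominated h"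
  using locally_submodular_dominated dominated_globally_submodular globally_submodular_locally
  by blast


section \<open>Deformations of the permutohedron\<close>

text \<open>Every \<open>u\<close> is a nonnegative combination of the rays of one chamber, on which
  \<open>ext h\<close> is linear; so the inequalities at the rays imply all others.\<close>

lemma weight_polytope_eq: "weight_polytope \<Phi> \<omega> h = {v. \<forall>u. u \<bullet> v \<le> ext h u}"
proof (intro equalityI subsetI)
  fix v assume v: "v \<in> weight_polytope \<Phi> \<omega> h"
  have "u \<bullet> v \<le> ext h u" for u
  proof -
    obtain w p where w: "w \<in> W" "u = w p" "p \<in> D"
      using chamber_cover[of u] by blast
    have lin: "linear w" by (rule weyl_group_linear[OF w(1)])
    have "u = w (\<Sum>i\<in>I. (p \<bullet> coroot (\<alpha> i)) *\<^sub>R \<omega> i)"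
      by (simp only: weight_expansion w)
    then have "u \<bullet> v = (\<Sum>i\<in>I. (p \<bullet> coroot (\<alpha> i)) * (w (\<omega> i) \<bullet> v))"
      by (simp add: linear_sum[OF lin] linear_scale[OF lin] inner_sum_left)
    also have "\<dots> \<le> (\<Sum>i\<in>I. (p \<bullet> coroot (\<alpha> i)) * h (w (\<omega> i)))"
      using v w by (intro sum_mono mult_left_mono)
        (auto simp: chamber_iff weight_polytope_def weight_rays_eq)
    also have "\<dots> = ext h u"
      using w by (simp add: ext_eq inner_vert)
    finally show ?thesis .
  qed
  then show "v \<in> {v. \<forall>u. u \<bullet> v \<le> ext h u}" by simp
next
  fix v assume "v \<in> {v. \<forall>u. u \<bullet> v \<le> ext h u}"
  then have "r \<bullet> v \<le> h r" if "r \<in> weight_rays \<Phi> \<omega>" for r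
    using ext_ray[OF that, of h] by (metis mem_Collect_eq)
  then show "v \<in> weight_polytope \<Phi> \<omega> h"
    by (simp add: weight_polytope_def)
qed

lemma vert_in_weight_polytope: "dominated h \<Longrightarrow> w \<in> W \<Longrightarrow> vert h w \<in> weight_polytope \<Phi> \<omega> h"
  by (simp add: weight_polytope_eq dominated_def)

text \<open>The bound \<open>h r\<close> is attained at a point \<open>vert h w\<close> of the
  polytope, so the polytope determines \<open>h\<close> on the rays. Restricting to
  \<open>extensional\<close> functions fixes the values elsewhere.\<close>

lemma weight_polytope_inj:
  "inj_on (weight_polytope \<Phi> \<omega>) {h \<in> extensional (weight_rays \<Phi> \<omega>). dominated h}"
proof (rule inj_onI)
  have le: "h r \<le> h' r"
    if h: "dominated h" "weight_polytope \<Phi> \<omega> h = weight_polytope \<Phi> \<omega> h'" "r \<in> weight_rays \<Phi> \<omega>"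
    for h h' r
  proof -
    obtain w i where w: "w \<in> W" "i \<in> I" "r = w (\<omega> i)"
      using h(3) by (auto simp: weight_rays_eq)
    have "vert h w \<in> weight_polytope \<Phi> \<omega> h'"
      using vert_in_weight_polytope h w by blast
    then have "r \<bullet> vert h w \<le> h' r"
      using h(3) by (simp add: weight_polytope_def)
    then show ?thesis
      using w by (simp add: weight_vert)
  qed
  fix h h'
  assume h: "h \<in> {h \<in> extensional (weight_rays \<Phi> \<omega>). dominated h}"
    "h' \<in> {h \<in> extensional (weight_rays \<Phi> \<omega>). dominated h}"
    "weight_polytope \<Phi> \<omega> h = weight_polytope \<Phi> \<omega> h'"
  show "h = h'"
  proof (rule extensionalityI)
    show "h \<in> extensional (weight_rays \<Phi> \<omega>)" "h' \<in> extensional (weight_rays \<Phi> \<omega>)"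
      using h by auto
    fix r assume "r \<in> weight_rays \<Phi> \<omega>"
    then show "h r = h' r"
      using le[of h h' r] le[of h' h r] h by force
  qed
qed

lemma polytope_weight_polytope: "polytope (weight_polytope \<Phi> \<omega> h)"
  unfolding polytope_eq_bounded_polyhedron
proof
  have "finite (weight_rays \<Phi> \<omega>)"
    unfolding weight_rays_def using finite_weyl_group[OF root_system] by simp
  moreover have "weight_polytope \<Phi> \<omega> h = \<Inter>((\<lambda>r. {v. r \<bullet> v \<le> h r}) ` weight_rays \<Phi> \<omega>)"
    by (auto simp: weight_polytope_def)
  ultimately show "polyhedron (weight_polytope \<Phi> \<omega> h)"
    by (auto intro!: polyhedron_Inter polyhedron_halfspace_le)
  \<comment> \<open>Boundedness: the values of \<open>ext h\<close> at the basis vectors and their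
    negatives bound the coordinates.\<close>
  have "v \<in> cbox (\<Sum>b\<in>Basis. - ext h (- b) *\<^sub>R b) (\<Sum>b\<in>Basis. ext h b *\<^sub>R b)"
    if "v \<in> weight_polytope \<Phi> \<omega> h" for v
  proof -
    have le: "u \<bullet> v \<le> ext h u" for u
      using that by (simp add: weight_polytope_eq)
    have "- ext h (- b) \<le> v \<bullet> b" "v \<bullet> b \<le> ext h b" for b
      using le[of "- b"] le[of b] by (simp_all add: inner_commute)
    then show ?thesis
      unfolding mem_box by (auto simp only: inner_sum_left_Basis)
  qed
  then show "bounded (weight_polytope \<Phi> \<omega> h)"
    by (intro bounded_subset[OF bounded_cbox]) blast
qed

text \<open>The face exposed by the interior direction \<open>w \<rho>\<close> is the single vertex
  \<open>vert h w\<close>, and its normal cone contains \<open>w D\<close>.\<close>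

lemma weight_polytope_deformation:
  assumes "dominated h"
  shows "permutohedron_deformation \<Phi> (weight_polytope \<Phi> \<omega> h)"
proof -
  let ?P = "weight_polytope \<Phi> \<omega> h"
  have conv: "convex ?P"
    using polytope_weight_polytope polytope_imp_convex by blast
  have cone: "\<exists>\<tau>\<in>normal_fan ?P. w ` D \<subseteq> \<tau>" if w: "w \<in> W" for w
  proof -
    let ?z = "w \<rho>"
    let ?F = "?P \<inter> {x. ?z \<bullet> x = ext h ?z}"
    have z: "?z \<in> w ` D"
      using rho_coroot by (auto simp: chamber_iff)
    have "?F face_of ?P"
      using conv by (intro face_of_Int_supporting_hyperplane_le) (auto simp: weight_polytope_eq)
    moreover have "vert h w \<in> ?F"
      using vert_in_weight_polytope[OF assms w] ext_eq[OF w z, of h] by simp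
    moreover have "w ` D \<subseteq> normal_cone ?P ?F"
    proof
      fix u assume u: "u \<in> w ` D"
      have F: "x = vert h w" if x: "x \<in> ?F" for x
      proof -
        have le: "w (\<omega> i) \<bullet> x \<le> h (w (\<omega> i))" if "i \<in> I" for i
          using x w that by (auto simp: weight_polytope_def weight_rays_eq)
        have lin: "linear w" by (rule weyl_group_linear[OF w])
        \<comment> \<open>As \<open>w \<rho>\<close> is the sum of the
          \<open>w (\<omega> i)\<close>, equality in the summed constraints forces equality in each
          one.\<close>
        have "?z \<bullet> x = (\<Sum>i\<in>I. w (\<omega> i) \<bullet> x)"
          by (simp add: \<rho>_def linear_sum[OF lin] inner_sum_left)
        moreover have "ext h ?z = (\<Sum>i\<in>I. h (w (\<omega> i)))"
          using ext_eq[OF w z] by (simp add: inner_vert[OF w] rho_coroot)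
        ultimately have "(\<Sum>i\<in>I. h (w (\<omega> i)) - w (\<omega> i) \<bullet> x) = 0"
          using x by (simp add: sum_subtractf)
        then have "\<forall>i\<in>I. h (w (\<omega> i)) - w (\<omega> i) \<bullet> x = 0"
          using le by (subst (asm) sum_nonneg_eq_0_iff) auto
        then show ?thesis
          using vert_eqI[OF w, of x h] by auto
      qed
      have "u \<bullet> y \<le> u \<bullet> vert h w" if "y \<in> ?P" for y
        using that ext_eq[OF w u, of h] by (metis (mono_tags) mem_Collect_eq weight_polytope_eq)
      then show "u \<in> normal_cone ?P ?F"
        using F unfolding normal_cone_def by blast
    qed
    ultimately show ?thesis
      unfolding normal_fan_def by blast
  qed
  then have sub: "\<exists>\<tau>\<in>normal_fan ?P. \<sigma> \<subseteq> \<tau>" if "\<sigma> \<in> coxeter_complex \<Phi>" for \<sigma>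
    using complex_subset_chamber[OF that] by (meson order_trans)
  then have "\<Union>(normal_fan ?P) = \<Union>(coxeter_complex \<Phi>)"
    using Union_complex by blast
  then have "coarsens (normal_fan ?P) (coxeter_complex \<Phi>)"
    using sub by (simp add: coarsens_def)
  moreover have "?P \<noteq> {}"
    using vert_in_weight_polytope[OF assms weyl_group_id] by blast
  ultimately show ?thesis
    by (simp add: permutohedron_deformation_def polytope_weight_polytope)
qed

text \<open>Each \<open>w D\<close> lies in one normal cone of \<open>P\<close>, so a single point
  \<open>v w\<close> of \<open>P\<close> maximizes all functionals from \<open>w D\<close>. The
  support function of \<open>P\<close> is thus linear on each chamber, and it is the extension of
  its values at the rays.\<close>

lemma deformation_weight_polytope:
  assumes "permutohedron_deformation \<Phi> P"
  shows "\<exists>h\<in>extensional (weight_rays \<Phi> \<omega>). dominated h \<and> weight_polytope \<Phi> \<omega> h = P"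
proof -
  have P: "polytope P" "coarsens (normal_fan P) (coxeter_complex \<Phi>)"
    using assms by (simp_all add: permutohedron_deformation_def)
  have "\<exists>v\<in>P. \<forall>u\<in>w ` D. \<forall>y\<in>P. u \<bullet> y \<le> u \<bullet> v" if w: "w \<in> W" for w
  proof -
    obtain \<tau> where "\<tau> \<in> normal_fan P" "w ` D \<subseteq> \<tau>"
      using P(2) chamber_in_complex[OF w] unfolding coarsens_def by blast
    then obtain F where F: "w ` D \<subseteq> normal_cone P F" "F face_of P" "F \<noteq> {}"
      unfolding normal_fan_def by blast
    then obtain v where v: "v \<in> F" by blast
    then have "\<forall>u\<in>w ` D. \<forall>y\<in>P. u \<bullet> y \<le> u \<bullet> v"
      using F(1) unfolding normal_cone_def by blast
    then show ?thesis
      using v face_of_imp_subset[OF F(2)] by blast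
  qed
  then obtain v where v: "\<And>w. w \<in> W \<Longrightarrow> v w \<in> P"
    and max: "\<And>w u y. w \<in> W \<Longrightarrow> u \<in> w ` D \<Longrightarrow> y \<in> P \<Longrightarrow> u \<bullet> y \<le> u \<bullet> v w"
    by metis
  define h where "h = restrict (\<lambda>r. Sup ((\<bullet>) r ` P)) (weight_rays \<Phi> \<omega>)"
  have sup: "Sup ((\<bullet>) u ` P) = u \<bullet> v w" if "w \<in> W" "u \<in> w ` D" for u w
    using v max that by (intro cSup_eq_maximum) auto
  have vert: "vert h w = v w" if w: "w \<in> W" for w
  proof (rule vert_eqI[OF w])
    fix i assume i: "i \<in> I"
    then have "w (\<omega> i) \<in> weight_rays \<Phi> \<omega>"
      using w by (auto simp: weight_rays_eq)
    then show "w (\<omega> i) \<bullet> v w = h (w (\<omega> i))"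
      using sup[OF w, of "w (\<omega> i)"] weight_in_chamber[OF i] by (simp add: h_def)
  qed
  have ge: "u \<bullet> y \<le> ext h u" if "y \<in> P" for u y
    using chamber_cover[of u] max[OF _ _ that] by (metis ext_eq vert)
  have "weight_polytope \<Phi> \<omega> h = P"
  proof
    show "P \<subseteq> weight_polytope \<Phi> \<omega> h"
      using ge by (auto simp: weight_polytope_eq)
    show "weight_polytope \<Phi> \<omega> h \<subseteq> P"
    proof (rule ccontr)
      assume "\<not> weight_polytope \<Phi> \<omega> h \<subseteq> P"
      then obtain y where y: "y \<in> weight_polytope \<Phi> \<omega> h" "y \<notin> P" by blast
      \<comment> \<open>A point outside \<open>P\<close> is separated from it strictly, whereas
        \<open>v w\<close> is in \<open>P\<close> and attains the bound that the polytope of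
        \<open>h\<close> imposes in direction \<open>- a\<close>.\<close>
      obtain a b where ab: "a \<bullet> y < b" "\<forall>x\<in>P. a \<bullet> x > b"
        using separating_hyperplane_closed_point[of P y] y(2) P(1) polytope_imp_convex
          polytope_imp_closed by blast
      obtain w where w: "w \<in> W" "- a \<in> w ` D"
        using chamber_cover by blast
      have "- a \<bullet> y \<le> - a \<bullet> v w"
        using y(1) ext_eq[OF w, of h] vert[OF w(1)] unfolding weight_polytope_eq by (metis mem_Collect_eq)
      then show False
        using ab v[OF w(1)] by force
    qed
  qed
  moreover have "dominated h"
    unfolding dominated_def using ge v by (simp add: vert)
  ultimately show ?thesis
    by (intro bexI[of _ h]) (auto simp: h_def)
qed

lemma weight_polytope_bij:
  "bij_betw (weight_polytope \<Phi> \<omega>) {h \<in> extensional (weight_rays \<Phi> \<omega>). dominated h}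
     {P. permutohedron_deformation \<Phi> P}"
proof (rule bij_betw_imageI[OF weight_polytope_inj])
  show "weight_polytope \<Phi> \<omega> ` {h \<in> extensional (weight_rays \<Phi> \<omega>). dominated h} =
      {P. permutohedron_deformation \<Phi> P}"
    using weight_polytope_deformation deformation_weight_polytope by blast
qed

end

theorem theorem5p2:
  fixes \<Phi> D :: "'a::euclidean_space set" and \<alpha> \<omega> :: "nat \<Rightarrow> 'a"
  assumes "root_system \<Phi>"
    and "D \<in> chambers \<Phi>"
    and "simple_roots \<Phi> D \<alpha>"
    and "fundamental_weights \<alpha> \<omega>"
  shows "(\<forall>h :: 'a \<Rightarrow> real.
            (submodular \<Phi> \<omega> h \<longleftrightarrow> locally_submodular \<Phi> \<alpha> \<omega> h) \<and>
            (submodular \<Phi> \<omega> h \<longleftrightarrow> globally_submodular \<Phi> \<omega> h)) \<and>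
         bij_betw (weight_polytope \<Phi> \<omega>)
           {h \<in> extensional (weight_rays \<Phi> \<omega>). locally_submodular \<Phi> \<alpha> \<omega> h}
           {P. permutohedron_deformation \<Phi> P} \<and>
         bij_betw (weight_polytope \<Phi> \<omega>)
           {h \<in> extensional (weight_rays \<Phi> \<omega>). globally_submodular \<Phi> \<omega> h}
           {P. permutohedron_deformation \<Phi> P}"
proof -
  interpret based_root_system \<Phi> D \<alpha> \<omega> "{1..DIM('a)}"
    by unfold_locales (use assms in auto)
  show ?thesis
    unfolding submodular_iff_dominated locally_submodular_iff_dominated
      globally_submodular_iff_dominated
    using weight_polytope_bij by blast
qed

end
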